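(* Let $r$ be a fixed rank. There is a constant $C'_r>0$ such that, if $m\ge C'_r\,n(\log n)^3$ entries of a generic symmetric $n\times n$ matrix $M$ of rank $r$ are sampled uniformly at random, then with probability at least $1-n^{-3}$ there are only finitely many symmetric $n\times n$ matrices $M'$ of rank $r$ agreeing with $M$ on the observed entries.
   Context: A symmetric $n\times n$ matrix $M$ of rank $r$ is generic if every polynomial with rational coefficients that vanishes at $M$ vanishes on the whole set of symmetric $n\times n$ matrices of rank $r$. Sampling $m$ entries uniformly at random means choosing a uniformly random set of $m$ entry positions. *)

theory Defs
  imports
    "HOL-Probability.Probability"
    "HOL-Library.Poly_Mapping"
    "Jordan_Normal_Form.DL_Rank"
begin

definition sym_rank_mats :: "nat \<Rightarrow> nat \<Rightarrow> 'a::field mat set" where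
  "sym_rank_mats n r =
     {M \<in> carrier_mat n n. transpose_mat M = M \<and> vec_space.rank n M = r}"

(* Polynomials with rational coefficients in variables x_v, v ranging over 'v:
   finitely supported maps from exponent vectors to coefficients. *)
type_synonym 'v rat_mpoly = "('v \<Rightarrow>\<^sub>0 nat) \<Rightarrow>\<^sub>0 rat"

definition mpoly_vars :: "'v rat_mpoly \<Rightarrow> 'v set" where
  "mpoly_vars p = (\<Union>e \<in> Poly_Mapping.keys p. Poly_Mapping.keys e)"

definition mpoly_eval :: "('v \<Rightarrow> 'a::field_char_0) \<Rightarrow> 'v rat_mpoly \<Rightarrow> 'a" where
  "mpoly_eval x p =
     (\<Sum>e \<in> Poly_Mapping.keys p. of_rat (Poly_Mapping.lookup p e) *
        (\<Prod>v \<in> Poly_Mapping.keys e. x v ^ Poly_Mapping.lookup e v))"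

(* Only the variables x_(i,j) with i, j < n are allowed, as entries of an n x n matrix
   outside this range are unspecified. *)
definition generic_sym_rank :: "nat \<Rightarrow> nat \<Rightarrow> 'a::field_char_0 mat \<Rightarrow> bool" where
  "generic_sym_rank n r M \<longleftrightarrow>
     M \<in> sym_rank_mats n r \<and>
     (\<forall>p :: (nat \<times> nat) rat_mpoly.
        mpoly_vars p \<subseteq> {..<n} \<times> {..<n} \<longrightarrow>
        mpoly_eval (\<lambda>ij. M $$ ij) p = 0 \<longrightarrow>
        (\<forall>N \<in> sym_rank_mats n r. mpoly_eval (\<lambda>ij. N $$ ij) p = (0::'a)))"

(* Positions (i,j) and (j,i) of a symmetric matrix carry the same entry, so each unordered
   position is represented once, diagonal included. *)
definition sym_positions :: "nat \<Rightarrow> (nat \<times> nat) set" where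
  "sym_positions n = {(i, j). i \<le> j \<and> j < n}"

(* Only meaningful for m \<le> card (sym_positions n): pmf_of_set of the empty set is unspecified. *)
definition sample_positions :: "nat \<Rightarrow> nat \<Rightarrow> (nat \<times> nat) set pmf" where
  "sample_positions n m = pmf_of_set {\<Omega>. \<Omega> \<subseteq> sym_positions n \<and> card \<Omega> = m}"

definition sym_completions ::
    "nat \<Rightarrow> nat \<Rightarrow> 'a::field mat \<Rightarrow> (nat \<times> nat) set \<Rightarrow> 'a mat set" where
  "sym_completions n r M \<Omega> =
     {M' \<in> sym_rank_mats n r. \<forall>ij \<in> \<Omega>. M' $$ ij = M $$ ij}"

end

(* Expand around the matrix U U^T whose rows are u_i = e_(c i), where c i = i mod r is a colouring
   of the indices. There the differential of the entry (i, j) is X_(i, c j) + X_(j, c i), so that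
   it is described by a graph which splits into one component for every pair of colours: a
   bipartite graph for two distinct colours, a graph with loops for equal ones. If the sampled
   positions meet every cut of these components, they contain d = dim (rank r locus) positions E
   with surjective differential, hence the entries in E are algebraically independent on the
   locus. A union bound over the cuts shows that this fails with probability at most n^-3.

   Conversely, the locus is a finite union of images of polynomial maps in d parameters, so by
   counting monomials any further entry satisfies, on each of these images, a nontrivial rational
   polynomial relation with the entries in E. By independence and genericity a coefficient of
   this relation does not vanish at M, so the entry takes only finitely many values. *)
theory Submission
  imports Defs "HOL-Library.Function_Algebras" "Jordan_Normal_Form.DL_Rank_Submatrix"
begin

section \<open>Polynomial functions with rational coefficients\<close>

text \<open>At a general point the differential of the entry (i, j) involves all coordinates of u_i
  and u_j. At the coloured point only two variables remain, which turns independence into a question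
  about graphs; one such point suffices, as algebraic independence concerns the locus as a whole.
  Its entries are 0 and 1, so shifting by it keeps coefficients rational, as genericity demands;
  hence polynomials are treated as rational spans of monomial functions.

  The dimension count has to be exact. On a bipartite component the differential of all positions
  has a one-dimensional kernel (opposite values on the two colours), whereas loops leave none. This
  costs one dimension for each of the r(r-1)/2 pairs of distinct colours, so d = nr - r(r-1)/2. The
  upper bound cannot use Gram matrices U U^T, which do not exhaust the locus over the reals; it uses
  U S U^T.

  The union bound converges because a cut with k vertices on its smaller side has at least nk/(8r)
  positions and is missed with probability at most n^(-9k), while at most about 2 n^k cuts have this
  size.\<close>

interpretation rat_fun: vector_space "\<lambda>(q::rat) (F::'z \<Rightarrow> 'a::field_char_0) z. of_rat q * F z"
  by unfold_locales (auto simp: fun_eq_iff algebra_simps of_rat_add of_rat_mult)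

text \<open>The degree is bounded in every variable separately, so that the spanning set has at most
  (D + 1)^|K| elements, which is what the dimension count needs.\<close>

definition poly_funs :: "'v set \<Rightarrow> nat \<Rightarrow> (('v \<Rightarrow> 'a::field_char_0) \<Rightarrow> 'a) set" where
  "poly_funs K D = rat_fun.span ((\<lambda>b z. \<Prod>v\<in>K. z v ^ b v) ` (PiE K (\<lambda>_. {..D})))"

lemma poly_funs_monomial:
  assumes "\<And>v. v \<in> K \<Longrightarrow> b v \<le> D"
  shows "(\<lambda>z. \<Prod>v\<in>K. z v ^ b v) \<in> poly_funs K D"
proof -
  have "(\<lambda>z. \<Prod>v\<in>K. z v ^ b v) = (\<lambda>z. \<Prod>v\<in>K. z v ^ restrict b K v)"
    by (intro ext prod.cong) auto
  moreover have "restrict b K \<in> PiE K (\<lambda>_. {..D})" using assms by auto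
  ultimately show ?thesis unfolding poly_funs_def
    by (intro rat_fun.span_base image_eqI[where x = "restrict b K"])
qed

lemma poly_funs_mono: "D \<le> E \<Longrightarrow> poly_funs K D \<subseteq> poly_funs K E"
  unfolding poly_funs_def by (intro rat_fun.span_mono image_mono PiE_mono) auto

lemma poly_funs_zero: "(\<lambda>z. 0) \<in> poly_funs K D"
  using rat_fun.span_zero unfolding poly_funs_def zero_fun_def .

lemma poly_funs_add:
  "F \<in> poly_funs K D \<Longrightarrow> G \<in> poly_funs K D \<Longrightarrow> (\<lambda>z. F z + G z) \<in> poly_funs K D"
  unfolding poly_funs_def by (drule (1) rat_fun.span_add) (simp add: plus_fun_def)

lemma poly_funs_scale: "F \<in> poly_funs K D \<Longrightarrow> (\<lambda>z. of_rat q * F z) \<in> poly_funs K D"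
  unfolding poly_funs_def by (rule rat_fun.span_scale)

lemma poly_funs_const: "(\<lambda>z. of_rat q) \<in> poly_funs K D"
  using poly_funs_scale[OF poly_funs_monomial[where b = "\<lambda>_. 0" and K = K and D = D], of q] by simp

lemma poly_funs_var:
  assumes "finite K" "v \<in> K" "D \<ge> 1"
  shows "(\<lambda>z. z v) \<in> poly_funs K D"
proof -
  have "(\<lambda>z. z v) = (\<lambda>z. \<Prod>w\<in>K. z w ^ (if w = v then 1 else 0))"
    using assms by (auto simp: fun_eq_iff if_distrib[of "power _"] cong: if_cong)
  also have "\<dots> \<in> poly_funs K D" using assms by (intro poly_funs_monomial) auto
  finally show ?thesis .
qed

lemma poly_funs_diff:
  assumes "F \<in> poly_funs K D" "G \<in> poly_funs K D"
  shows "(\<lambda>z. F z - G z) \<in> poly_funs K D"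
  using poly_funs_add[OF assms(1) poly_funs_scale[OF assms(2), of "-1"]] by simp

lemma poly_funs_mult:
  assumes F: "F \<in> poly_funs K D" and G: "G \<in> poly_funs K E"
  shows "(\<lambda>z. F z * G z) \<in> poly_funs K (D + E)"
  using F unfolding poly_funs_def[of K D]
proof (induction rule: rat_fun.span_induct_alt)
  case base
  then show ?case using poly_funs_zero by (simp add: zero_fun_def)
next
  case (step q F' F)
  then obtain b where b: "b \<in> PiE K (\<lambda>_. {..D})" "F' = (\<lambda>z. \<Prod>v\<in>K. z v ^ b v)" by auto
  have "(\<lambda>z. F' z * G z) \<in> poly_funs K (D + E)"
    using G unfolding poly_funs_def[of K E]
  proof (induction rule: rat_fun.span_induct_alt)
    case base
    then show ?case using poly_funs_zero by (simp add: zero_fun_def)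
  next
    case (step q' G' G)
    then obtain b' where b': "b' \<in> PiE K (\<lambda>_. {..E})" "G' = (\<lambda>z. \<Prod>v\<in>K. z v ^ b' v)" by auto
    have "(\<lambda>z. F' z * G' z) = (\<lambda>z. \<Prod>v\<in>K. z v ^ (b v + b' v))"
      by (simp add: b b' power_add prod.distrib)
    also have "\<dots> \<in> poly_funs K (D + E)"
      using b(1) b'(1) by (intro poly_funs_monomial add_mono) auto
    finally have "(\<lambda>z. of_rat q' * (F' z * G' z) + F' z * G z) \<in> poly_funs K (D + E)"
      using step by (intro poly_funs_add poly_funs_scale)
    then show ?case by (simp add: plus_fun_def algebra_simps)
  qed
  then have "(\<lambda>z. of_rat q * (F' z * G z) + F z * G z) \<in> poly_funs K (D + E)"
    using step by (intro poly_funs_add poly_funs_scale)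
  then show ?case by (simp add: plus_fun_def algebra_simps)
qed

lemma poly_funs_sum:
  "(\<And>i. i \<in> A \<Longrightarrow> F i \<in> poly_funs K D) \<Longrightarrow> (\<lambda>z. \<Sum>i\<in>A. F i z) \<in> poly_funs K D"
  by (induction A rule: infinite_finite_induct) (auto intro: poly_funs_zero poly_funs_add)

lemma poly_funs_power:
  "F \<in> poly_funs K D \<Longrightarrow> (\<lambda>z. F z ^ k) \<in> poly_funs K (D * k)"
proof (induction k)
  case 0
  then show ?case using poly_funs_const[of 1] by simp
next
  case (Suc k)
  then show ?case using poly_funs_mult[of F K D "\<lambda>z. F z ^ k"] by simp
qed

lemma poly_funs_prod:
  "(\<And>i. i \<in> A \<Longrightarrow> F i \<in> poly_funs K D) \<Longrightarrow> (\<lambda>z. \<Prod>i\<in>A. F i z) \<in> poly_funs K (D * card A)"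
proof (induction A rule: infinite_finite_induct)
  case (insert i A)
  then show ?case using poly_funs_mult[of "F i" K D "\<lambda>z. \<Prod>i\<in>A. F i z"] by simp
qed (use poly_funs_const[of 1] in auto)

section \<open>From polynomial functions to formal rational polynomials\<close>

lemma mpoly_eval_superset:
  assumes "finite S" "Poly_Mapping.keys p \<subseteq> S"
  shows "mpoly_eval x p = (\<Sum>e \<in> S. of_rat (Poly_Mapping.lookup p e) *
        (\<Prod>v \<in> Poly_Mapping.keys e. x v ^ Poly_Mapping.lookup e v))"
  unfolding mpoly_eval_def using assms
  by (intro sum.mono_neutral_left) (auto simp: in_keys_iff)

lemma mpoly_eval_add: "mpoly_eval x (p + q) = mpoly_eval x p + mpoly_eval x q"
proof -
  let ?S = "Poly_Mapping.keys p \<union> Poly_Mapping.keys q"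
  have "finite ?S" "Poly_Mapping.keys (p + q) \<subseteq> ?S"
    using Poly_Mapping.keys_add[of p q] by simp_all
  moreover have "Poly_Mapping.keys p \<subseteq> ?S" "Poly_Mapping.keys q \<subseteq> ?S" by auto
  ultimately show ?thesis
    by (simp only: mpoly_eval_superset[of ?S] lookup_add of_rat_add distrib_right sum.distrib)
qed

text \<open>The bridge to \<open>generic_sym_rank\<close>, which quantifies over formal polynomials
  in the variables of the index square.\<close>

lemma poly_funs_eq_mpoly_eval:
  fixes F :: "('v \<Rightarrow> 'a::field_char_0) \<Rightarrow> 'a"
  assumes "finite K" "F \<in> poly_funs K D"
  shows "\<exists>p. mpoly_vars p \<subseteq> K \<and> (\<forall>x. mpoly_eval x p = F x)"
  using assms(2) unfolding poly_funs_def
proof (induction rule: rat_fun.span_induct_alt)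
  case base
  show ?case by (rule exI[of _ 0]) (auto simp: mpoly_vars_def mpoly_eval_def)
next
  case (step q F' F)
  then obtain p where p: "mpoly_vars p \<subseteq> K" "\<And>x. mpoly_eval x p = F x" by auto
  obtain b where b: "b \<in> PiE K (\<lambda>_. {..D})" "F' = (\<lambda>z. \<Prod>v\<in>K. z v ^ b v)" using step by auto
  define e where "e = Abs_poly_mapping (\<lambda>v. if v \<in> K then b v else 0)"
  have e: "Poly_Mapping.lookup e v = (if v \<in> K then b v else 0)" for v
    unfolding e_def by (subst Abs_poly_mapping_inverse) (auto intro: finite_subset[OF _ assms(1)])
  have ke: "Poly_Mapping.keys e \<subseteq> K" by (auto simp: in_keys_iff e split: if_splits)
  have ev: "mpoly_eval x (Poly_Mapping.single e q) = of_rat q * F' x" for x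
  proof -
    have "(\<Prod>v\<in>Poly_Mapping.keys e. x v ^ Poly_Mapping.lookup e v) = (\<Prod>v\<in>K. x v ^ Poly_Mapping.lookup e v)"
      using ke assms(1) by (intro prod.mono_neutral_left) (auto simp: in_keys_iff)
    also have "\<dots> = F' x" by (simp add: b e)
    finally show ?thesis
      by (subst mpoly_eval_superset[of "{e}"]) simp_all
  qed
  have "Poly_Mapping.keys (Poly_Mapping.single e q + p) \<subseteq> insert e (Poly_Mapping.keys p)"
    using Poly_Mapping.keys_add[of "Poly_Mapping.single e q" p] by (auto split: if_splits)
  then have "mpoly_vars (Poly_Mapping.single e q + p) \<subseteq> K"
    using ke p(1) unfolding mpoly_vars_def by blast
  then show ?case using p(2) ev
    by (intro exI[of _ "Poly_Mapping.single e q + p"]) (auto simp: mpoly_eval_add)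
qed

text \<open>More functions than variables are algebraically dependent over the rationals: there are
  (D + 1)^|A| products of powers up to D, inside a space of dimension at most (s |A| D + 1)^|K|, and
  the larger exponent |A| wins for large D.\<close>

lemma poly_funs_dependent:
  fixes f :: "'e \<Rightarrow> ('v \<Rightarrow> 'a::field_char_0) \<Rightarrow> 'a"
  assumes K: "finite K" and A: "finite A" "card K < card A"
    and f: "\<And>e. e \<in> A \<Longrightarrow> f e \<in> poly_funs K s"
  shows "\<exists>D a. (\<exists>\<alpha>\<in>PiE A (\<lambda>_. {..D}). a \<alpha> \<noteq> 0) \<and>
    (\<forall>z. (\<Sum>\<alpha>\<in>PiE A (\<lambda>_. {..D}). of_rat (a \<alpha>) * (\<Prod>e\<in>A. f e z ^ \<alpha> e)) = 0)"
proof -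
  define N where "N = s * card A"
  \<comment> \<open>Chosen so that (N + 1)^|K| = D < D + 1, which beats the constant factor in (N D
    + 1)^|K| <= (N + 1)^|K| (D + 1)^|K|.\<close>
  define D where "D = (N + 1) ^ card K"
  define P where "P = PiE A (\<lambda>_. {..D})"
  define \<Phi> where "\<Phi> \<alpha> = (\<lambda>z. \<Prod>e\<in>A. f e z ^ \<alpha> e)" for \<alpha>
  define T :: "(('v \<Rightarrow> 'a) \<Rightarrow> 'a) set" where "T = (\<lambda>b z. \<Prod>v\<in>K. z v ^ b v) ` (PiE K (\<lambda>_. {..N * D}))"
  have fP: "finite P" unfolding P_def using A by (auto intro: finite_PiE)
  have cP: "card P = (D + 1) ^ card A" using A by (simp add: P_def card_PiE)
  have "\<Phi> \<alpha> \<in> poly_funs K (N * D)" if "\<alpha> \<in> P" for \<alpha>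
  proof -
    have "(\<lambda>z. f e z ^ \<alpha> e) \<in> poly_funs K (s * D)" if "e \<in> A" for e
    proof -
      have "\<alpha> e \<le> D" using \<open>\<alpha> \<in> P\<close> that by (auto simp: P_def)
      then show ?thesis
        using poly_funs_power[OF f[OF that], of "\<alpha> e"] poly_funs_mono[of "s * \<alpha> e" "s * D" K] by auto
    qed
    then have "\<Phi> \<alpha> \<in> poly_funs K (s * D * card A)" unfolding \<Phi>_def by (rule poly_funs_prod)
    then show ?thesis by (simp add: N_def mult_ac)
  qed
  then have span: "\<Phi> ` P \<subseteq> rat_fun.span T" by (auto simp: poly_funs_def T_def)
  have fT: "finite T" unfolding T_def using K by (auto intro: finite_PiE)
  have "card T \<le> card (PiE K (\<lambda>_. {..N * D}))"
    unfolding T_def using K by (intro card_image_le) (auto intro: finite_PiE)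
  also have "\<dots> = (N * D + 1) ^ card K" using K by (simp add: card_PiE)
  also have "\<dots> \<le> ((N + 1) * (D + 1)) ^ card K" by (intro power_mono) auto
  also have "\<dots> < (D + 1) ^ (card K + 1)"
  proof -
    have "(D + 1) ^ (card K + 1) = (D + 1) * (D + 1) ^ card K" by simp
    moreover have "(N + 1) ^ card K * (D + 1) ^ card K < (D + 1) * (D + 1) ^ card K"
      unfolding D_def[symmetric] by (intro mult_strict_right_mono) auto
    ultimately show ?thesis by (simp only: power_mult_distrib)
  qed
  also have "\<dots> \<le> card P" unfolding cP using A by (intro power_increasing) auto
  finally have TP: "card T < card P" .
  have "\<exists>a. (\<exists>\<alpha>\<in>P. a \<alpha> \<noteq> 0) \<and> (\<forall>z. (\<Sum>\<alpha>\<in>P. of_rat (a \<alpha>) * \<Phi> \<alpha> z) = 0)"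
  proof (cases "inj_on \<Phi> P")
    \<comment> \<open>\<open>rat_fun.dependent\<close> speaks of sets of functions, so two products
      that coincide as functions are treated apart: their difference is the relation.\<close>
    case False
    then obtain \<alpha> \<beta> where ab: "\<alpha> \<in> P" "\<beta> \<in> P" "\<alpha> \<noteq> \<beta>" "\<Phi> \<alpha> = \<Phi> \<beta>" by (auto simp: inj_on_def)
    define a :: "_ \<Rightarrow> rat" where "a = (\<lambda>x. if x = \<alpha> then 1 else if x = \<beta> then -1 else 0)"
    have "(\<Sum>x\<in>P. of_rat (a x) * \<Phi> x z) = 0" for z
    proof -
      have "(\<Sum>x\<in>P. of_rat (a x) * \<Phi> x z) = (\<Sum>x\<in>{\<alpha>,\<beta>}. of_rat (a x) * \<Phi> x z)"
        using ab fP by (intro sum.mono_neutral_right) (auto simp: a_def)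
      also have "\<dots> = 0" using ab by (simp add: a_def)
      finally show ?thesis .
    qed
    then show ?thesis using ab(1) by (intro exI[of _ a]) (auto simp: a_def)
  next
    case True
    have "rat_fun.dependent (\<Phi> ` P)"
    proof (rule ccontr)
      assume "\<not> rat_fun.dependent (\<Phi> ` P)"
      from rat_fun.independent_span_bound[OF fT this span] have "card (\<Phi> ` P) \<le> card T" by auto
      then show False using TP card_image[OF True] by simp
    qed
    then obtain u where u: "\<exists>v\<in>\<Phi> ` P. u v \<noteq> 0" "(\<Sum>v\<in>\<Phi> ` P. (\<lambda>z. of_rat (u v) * v z)) = 0"
      using rat_fun.dependent_finite[of "\<Phi> ` P"] fP by auto
    have ap: "(\<Sum>v\<in>S. (\<lambda>z. of_rat (u v) * v z)) z = (\<Sum>v\<in>S. of_rat (u v) * v z)"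
      for S :: "(('v \<Rightarrow> 'a) \<Rightarrow> 'a) set" and z
      by (induction S rule: infinite_finite_induct) (auto simp: zero_fun_def plus_fun_def)
    have "(\<Sum>\<alpha>\<in>P. of_rat (u (\<Phi> \<alpha>)) * \<Phi> \<alpha> z) = 0" for z
      using fun_cong[OF u(2), of z] unfolding ap by (simp add: sum.reindex[OF True] zero_fun_def)
    then show ?thesis using u(1) by (intro exI[of _ "\<lambda>\<alpha>. u (\<Phi> \<alpha>)"]) auto
  qed
  then show ?thesis unfolding P_def \<Phi>_def by blast
qed

lemma sum_PiE_insert:
  assumes "finite A" "e \<notin> A"
  shows "(\<Sum>\<alpha>\<in>PiE (insert e A) (\<lambda>_. B). G \<alpha>) = (\<Sum>k\<in>B. \<Sum>\<beta>\<in>PiE A (\<lambda>_. B). G (\<beta>(e := k)))"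
proof -
  have "(\<Sum>\<alpha>\<in>PiE (insert e A) (\<lambda>_. B). G \<alpha>) =
      (\<Sum>(k, \<beta>)\<in>B \<times> PiE A (\<lambda>_. B). G (\<beta>(e := k)))"
    unfolding PiE_insert_eq using inj_combinator[OF assms(2), of "\<lambda>_. B"]
    by (subst sum.reindex) (auto simp: case_prod_beta)
  then show ?thesis by (simp add: sum.cartesian_product)
qed

text \<open>Induction on the number of variables: fix the others so that one coefficient in the new
  variable survives; the resulting univariate polynomial has finitely many roots in an infinite
  field.\<close>

lemma multivariate_nonvanishing:
  fixes c :: "('e \<Rightarrow> nat) \<Rightarrow> 'a::real_normed_field"
  assumes "finite A" "\<alpha> \<in> PiE A (\<lambda>_. {..D})" "c \<alpha> \<noteq> 0"
  shows "\<exists>y. (\<Sum>\<alpha>\<in>PiE A (\<lambda>_. {..D}). c \<alpha> * (\<Prod>e\<in>A. y e ^ \<alpha> e)) \<noteq> 0"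
  using assms
proof (induction A arbitrary: c \<alpha> rule: finite_induct)
  case empty
  then show ?case by simp
next
  case (insert e A)
  obtain k \<beta> where k: "k \<le> D" and \<beta>: "\<beta> \<in> PiE A (\<lambda>_. {..D})" "\<alpha> = \<beta>(e := k)"
    using insert.prems(1) unfolding PiE_insert_eq by auto
  have "c (\<beta>(e := k)) \<noteq> 0" using insert.prems(2) unfolding \<beta>(2) .
  from insert.IH[where c = "\<lambda>\<beta>. c (\<beta>(e := k))", OF \<beta>(1) this] obtain y
    where y: "(\<Sum>\<beta>\<in>PiE A (\<lambda>_. {..D}). c (\<beta>(e := k)) * (\<Prod>e\<in>A. y e ^ \<beta> e)) \<noteq> 0" ..
  define d where "d k = (\<Sum>\<beta>\<in>PiE A (\<lambda>_. {..D}). c (\<beta>(e := k)) * (\<Prod>e\<in>A. y e ^ \<beta> e))" for k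
  have "finite {t. (\<Sum>k\<le>D. d k * t ^ k) = 0}"
    by (rule polyfun_roots_finite[OF _ k]) (use y in \<open>simp add: d_def\<close>)
  then obtain t where t: "(\<Sum>k\<le>D. d k * t ^ k) \<noteq> 0"
    using ex_new_if_finite[OF infinite_UNIV_char_0, of "{t. (\<Sum>k\<le>D. d k * t ^ k) = 0}"] by auto
  have upd: "(\<Prod>e'\<in>insert e A. (y(e := t)) e' ^ (\<beta>(e := k)) e') = t ^ k * (\<Prod>e\<in>A. y e ^ \<beta> e)" for \<beta> k
  proof -
    have "(\<Prod>e'\<in>A. (y(e := t)) e' ^ (\<beta>(e := k)) e') = (\<Prod>e\<in>A. y e ^ \<beta> e)"
      using insert by (intro prod.cong) auto
    then show ?thesis using insert by simp
  qed
  have "(\<Sum>\<alpha>\<in>PiE (insert e A) (\<lambda>_. {..D}). c \<alpha> * (\<Prod>e'\<in>insert e A. (y(e := t)) e' ^ \<alpha> e'))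
      = (\<Sum>k\<le>D. d k * t ^ k)"
    unfolding sum_PiE_insert[OF insert.hyps(1,2)] upd d_def sum_distrib_right
    by (intro sum.cong refl) (simp only: mult_ac)
  then show ?case using t by (intro exI[of _ "y(e := t)"]) (simp only: not_False_eq_True)
qed

section \<open>Factorizations of symmetric matrices of given rank\<close>

lemma rank_sum_rank_one_le:
  fixes W V :: "nat \<Rightarrow> nat \<Rightarrow> 'a::field"
  shows "vec_space.rank n (Matrix.mat n n (\<lambda>(i, j). \<Sum>b<s. W i b * V j b)) \<le> s"
proof (induction s)
  case 0
  have "Matrix.mat n n (\<lambda>(i, j). \<Sum>b<0. W i b * V j b) = 0\<^sub>m n n" by auto
  then show ?case using vec_space.rank_0I[of n n, where ?'a = 'a] by (simp only: le_zero_eq)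
next
  case (Suc s)
  let ?A = "Matrix.mat n n (\<lambda>(i, j). \<Sum>b<s. W i b * V j b)"
  let ?B = "Matrix.mat n n (\<lambda>(i, j). W i s * V j s)"
  have "Matrix.mat n n (\<lambda>(i, j). \<Sum>b<Suc s. W i b * V j b) = ?A + ?B" by auto
  moreover have "vec_space.rank n (?A + ?B) \<le> vec_space.rank n ?A + vec_space.rank n ?B"
    by (rule vec_space.rank_subadditive[where nc = n]) auto
  moreover have "vec_space.rank n ?B \<le> 1"
    by (rule vec_space.rank_le_1_product_entries[where nc = n and f = "\<lambda>i. W i s" and g = "\<lambda>j. V j s"]) auto
  ultimately show ?case using Suc by simp
qed

text \<open>A sum of r rank-one matrices has rank at most r, and the leading r x r minor forces
  equality. Nonvanishing of a minor is an open condition, hence it persists along a curve near the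
  base point.\<close>

lemma gram_mem_sym_rank_mats:
  fixes W :: "nat \<Rightarrow> nat \<Rightarrow> 'a::field"
  assumes "r \<le> n" "Determinant.det (Matrix.mat r r (\<lambda>(i, j). \<Sum>b<r. W i b * W j b)) \<noteq> 0"
  shows "Matrix.mat n n (\<lambda>(i, j). \<Sum>b<r. W i b * W j b) \<in> sym_rank_mats n r"
proof -
  let ?N = "Matrix.mat n n (\<lambda>(i, j). \<Sum>b<r. W i b * W j b)"
  have c: "card {i. i < n \<and> i \<in> {..<r}} = r"
  proof -
    have "{i. i < n \<and> i \<in> {..<r}} = {..<r}" using assms(1) by auto
    then show ?thesis by simp
  qed
  have pick: "pick {..<r} i = i" if "i < r" for i
  proof -
    have "{a \<in> {..<r}. a < i} = {..<i}" using that by auto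
    then show ?thesis using pick_card_in_set[of i "{..<r}"] that by simp
  qed
  have "submatrix ?N {..<r} {..<r} = Matrix.mat r r (\<lambda>(i, j). \<Sum>b<r. W i b * W j b)"
    using c assms(1) by (intro eq_matI) (auto simp: submatrix_def pick)
  then have "r \<le> vec_space.rank n ?N"
    using vec_space.rank_gt_minor[of ?N n n "{..<r}" "{..<r}"] assms(2) c by simp
  moreover have "vec_space.rank n ?N \<le> r" by (rule rank_sum_rank_one_le)
  moreover have "transpose_mat ?N = ?N" by (intro eq_matI) (auto simp: mult.commute)
  ultimately show ?thesis unfolding sym_rank_mats_def by simp
qed

text \<open>\<open>I\<close> indexes a maximal independent set of columns and row j of
  \<open>Y\<close> holds the coordinates of column j. Equal columns are one element of the set
  \<open>S\<close>, so \<open>g\<close> selects one index for each vector.\<close>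

lemma column_basis:
  fixes M :: "'a::field mat"
  assumes M: "M \<in> carrier_mat n n" and r: "vec_space.rank n M = r"
  obtains I Y where "I \<subseteq> {..<n}" "card I = r"
    "\<And>a b. a \<in> I \<Longrightarrow> b \<in> I \<Longrightarrow> Y a b = (if a = b then 1 else 0)"
    "\<And>i j. i < n \<Longrightarrow> j < n \<Longrightarrow> M $$ (i, j) = (\<Sum>a\<in>I. Y j a * M $$ (i, a))"
proof -
  interpret vec_space "TYPE('a)" n .
  have cM: "set (cols M) \<subseteq> carrier_vec n" using M cols_dim by blast
  obtain S where S: "finite S" "maximal S (\<lambda>T. T \<subseteq> set (cols M) \<and> lin_indpt T)"
  proof -
    have "lin_indpt {}"
      by (metis empty_subsetI fin_dim finite_basis_exists subset_li_is_li vec_vs vectorspace.basis_def)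
    then show ?thesis
      using maximal_exists_superset[of "set (cols M)" "\<lambda>T. T \<subseteq> set (cols M) \<and> lin_indpt T" "{}"] that
      by auto
  qed
  have Sc: "S \<subseteq> set (cols M)" and li: "lin_indpt S" using S(2) by (auto simp: maximal_def)
  have Sv: "S \<subseteq> carrier_vec n" using Sc cM by blast
  have cS: "card S = r" using rank_card_indpt[OF M S(2)] r by simp
  have span: "v \<in> span S" if v: "v \<in> set (cols M)" for v
  proof (rule ccontr)
    assume nv: "v \<notin> span S"
    then have "lin_indpt (S \<union> {v})"
      using lin_dep_iff_in_span[of S v] li Sv v cM span_mem by blast
    then have "S \<union> {v} = S" using S(2) v Sc unfolding maximal_def by blast
    then show False using nv Sv span_mem by blast
  qed
  have "\<exists>A. v = lincomb A S" if "v \<in> set (cols M)" for v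
    using span[OF that] finite_in_span[OF S(1) Sv] by metis
  then obtain A where A: "\<And>v. v \<in> set (cols M) \<Longrightarrow> v = lincomb (A v) S" by metis
  have "\<exists>i<n. col M i = v" if "v \<in> S" for v
    using subsetD[OF Sc that] M by (auto simp: cols_def)
  then obtain g where g: "\<And>v. v \<in> S \<Longrightarrow> g v < n \<and> col M (g v) = v" by metis
  have inj: "inj_on g S" using g by (metis inj_onI)
  define I where "I = g ` S"
  \<comment> \<open>For j in \<open>I\<close> the unit vector is prescribed, which spares an appeal
    to uniqueness of coordinates.\<close>
  define Y where "Y j a = (if j \<in> I then (if j = a then 1 else 0) else A (col M j) (col M a))" for j a
  show ?thesis
  proof (rule that[of I Y])
    show "I \<subseteq> {..<n}" using g by (auto simp: I_def)
    show "card I = r" using cS card_image[OF inj] by (simp add: I_def)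
    show "Y a b = (if a = b then 1 else 0)" if "a \<in> I" "b \<in> I" for a b using that by (simp add: Y_def)
    have fI: "finite I" using S by (simp add: I_def)
    show "M $$ (i, j) = (\<Sum>a\<in>I. Y j a * M $$ (i, a))" if "i < n" "j < n" for i j
    proof (cases "j \<in> I")
      case True
      have "(\<Sum>a\<in>I. Y j a * M $$ (i, a)) = (\<Sum>a\<in>I. if a = j then M $$ (i, a) else 0)"
        using True by (intro sum.cong) (auto simp: Y_def)
      then show ?thesis using True fI by simp
    next
      case False
      have "col M j \<in> set (cols M)" using that M by (auto simp: cols_def)
      then have "vec_index (col M j) i = vec_index (lincomb (A (col M j)) S) i" using A by metis
      also have "\<dots> = (\<Sum>v\<in>S. A (col M j) v * vec_index v i)" by (rule lincomb_index[OF that(1) Sv])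
      also have "\<dots> = (\<Sum>a\<in>I. A (col M j) (col M a) * vec_index (col M a) i)"
        unfolding I_def sum.reindex[OF inj] using g by (intro sum.cong) auto
      also have "\<dots> = (\<Sum>a\<in>I. Y j a * M $$ (i, a))"
      proof (rule sum.cong)
        fix a assume "a \<in> I"
        then have "a < n" using g by (auto simp: I_def)
        then show "A (col M j) (col M a) * vec_index (col M a) i = Y j a * M $$ (i, a)"
          using False that M by (simp add: Y_def)
      qed simp
      finally show ?thesis using that M by simp
    qed
  qed
qed

text \<open>Expand in the basic columns, pass to rows by symmetry and expand again. The block of
  \<open>M\<close> on \<open>I\<close> serves as the core, so no square roots are taken and the
  field is arbitrary.\<close>

lemma sym_rank_mats_factorization:
  fixes M :: "'a::field mat"
  assumes "M \<in> sym_rank_mats n r"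
  obtains I Y where "I \<subseteq> {..<n}" "card I = r"
    "\<And>a b. a \<in> I \<Longrightarrow> b \<in> I \<Longrightarrow> Y a b = (if a = b then 1 else 0)"
    "\<And>i j. i < n \<Longrightarrow> j < n \<Longrightarrow> M $$ (i, j) = (\<Sum>a\<in>I. \<Sum>b\<in>I. Y i a * M $$ (a, b) * Y j b)"
proof -
  have M: "M \<in> carrier_mat n n" "transpose_mat M = M" "vec_space.rank n M = r"
    using assms by (auto simp: sym_rank_mats_def)
  have sym: "M $$ (i, j) = M $$ (j, i)" if "i < n" "j < n" for i j
    using arg_cong[OF M(2), of "\<lambda>A. A $$ (i, j)"] that M(1) by simp
  obtain I Y where I: "I \<subseteq> {..<n}" "card I = r"
    and Y: "\<And>a b. a \<in> I \<Longrightarrow> b \<in> I \<Longrightarrow> Y a b = (if a = b then 1 else 0)"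
    and eq: "\<And>i j. i < n \<Longrightarrow> j < n \<Longrightarrow> M $$ (i, j) = (\<Sum>a\<in>I. Y j a * M $$ (i, a))"
    using column_basis[OF M(1,3)] by blast
  have "M $$ (i, j) = (\<Sum>a\<in>I. \<Sum>b\<in>I. Y i a * M $$ (a, b) * Y j b)" if ij: "i < n" "j < n" for i j
  proof -
    have "M $$ (i, j) = (\<Sum>a\<in>I. Y i a * M $$ (j, a))" using sym[OF ij] eq[OF ij(2,1)] by simp
    also have "\<dots> = (\<Sum>a\<in>I. Y i a * M $$ (a, j))"
      using I ij sym[of j] by (intro sum.cong) auto
    also have "\<dots> = (\<Sum>a\<in>I. Y i a * (\<Sum>b\<in>I. Y j b * M $$ (a, b)))"
      using I ij eq[of _ j] by (intro sum.cong) auto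
    finally show ?thesis by (simp add: sum_distrib_left mult_ac)
  qed
  then show ?thesis using that I Y by blast
qed

section \<open>Finiteness of the completions\<close>

text \<open>Gram matrix of the vectors \<open>u_i = e_(i mod r)\<close>: the base point around which the rank-\<open>r\<close>
  matrices are expanded.\<close>
definition colour_gram :: "nat \<Rightarrow> nat \<times> nat \<Rightarrow> 'a::field_char_0" where
  "colour_gram r = (\<lambda>(i, j). if i mod r = j mod r then 1 else 0)"

text \<open>On the curve \<open>(U + t X) (U + t X)\<^sup>T\<close> through the base point, each shifted entry in \<open>E\<close> is
  \<open>t (y + O(t))\<close> with \<open>y\<close> arbitrary, so only the lowest-degree part of the polynomial survives as
  \<open>t\<close> tends to 0.\<close>
lemma gram_nonvanishing:
  fixes a :: "(nat \<times> nat \<Rightarrow> nat) \<Rightarrow> rat"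
  assumes r: "0 < r" "r \<le> n" and E: "E \<subseteq> {..<n} \<times> {..<n}"
    and onto: "\<And>y. \<exists>X::nat \<Rightarrow> nat \<Rightarrow> 'a::real_normed_field.
      \<forall>(i, j)\<in>E. X i (j mod r) + X j (i mod r) = y (i, j)"
    and nz: "\<beta>0 \<in> PiE E (\<lambda>_. {..D})" "a \<beta>0 \<noteq> 0"
  shows "\<exists>N\<in>sym_rank_mats n r. (\<Sum>\<beta>\<in>PiE E (\<lambda>_. {..D}).
    of_rat (a \<beta>) * (\<Prod>e\<in>E. (N $$ e - (colour_gram r e :: 'a)) ^ \<beta> e)) \<noteq> 0"
proof -
  have finE: "finite E" using E by (rule finite_subset) simp
  let ?P = "PiE E (\<lambda>_. {..D})"
  obtain \<beta>1 where b1: "\<beta>1 \<in> ?P" "a \<beta>1 \<noteq> 0"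
    and least: "\<And>\<beta>. \<beta> \<in> ?P \<Longrightarrow> a \<beta> \<noteq> 0 \<Longrightarrow> sum \<beta>1 E \<le> sum \<beta> E"
    using ex_has_least_nat[of "\<lambda>\<beta>. \<beta> \<in> ?P \<and> a \<beta> \<noteq> 0" \<beta>0 "\<lambda>\<beta>. sum \<beta> E"] nz by auto
  define k where "k = sum \<beta>1 E"
  define c :: "_ \<Rightarrow> 'a" where "c \<beta> = (if sum \<beta> E = k then of_rat (a \<beta>) else 0)" for \<beta>
  have "c \<beta>1 \<noteq> 0" using b1 by (simp add: c_def k_def)
  from multivariate_nonvanishing[where c = c, OF finE b1(1) this] obtain y
    where y: "(\<Sum>\<beta>\<in>?P. c \<beta> * (\<Prod>e\<in>E. y e ^ \<beta> e)) \<noteq> 0" ..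
  obtain X :: "nat \<Rightarrow> nat \<Rightarrow> 'a" where X: "\<And>i j. (i, j) \<in> E \<Longrightarrow> X i (j mod r) + X j (i mod r) = y (i, j)"
    using onto[of y] by auto
  define W where "W t i b = (if b = i mod r then 1 else 0) + t * X i b" for t i b
  define R where "R = (\<lambda>(i, j). \<Sum>b<r. X i b * X j b)"
  define N where "N t = Matrix.mat n n (\<lambda>(i, j). \<Sum>b<r. W t i b * W t j b)" for t
  define G where "G t = Matrix.mat r r (\<lambda>(i, j). \<Sum>b<r. W t i b * W t j b)" for t
  \<comment> \<open>The value on the curve divided by t^k. Where the subtraction truncates, the
    coefficient is zero by minimality of k; at t = 0 only the part of degree k remains, because 0 ^
    0 = 1.\<close>
  define g where "g t = (\<Sum>\<beta>\<in>?P. of_rat (a \<beta>) * t ^ (sum \<beta> E - k) * (\<Prod>e\<in>E. (y e + t * R e) ^ \<beta> e))" for t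
  have W0: "(\<Sum>b<r. W 0 i b * W 0 j b) = colour_gram r (i, j)" for i j
  proof -
    have "(\<Sum>b<r. W 0 i b * W 0 j b) = (\<Sum>b<r. if b = i mod r then colour_gram r (i, j) else 0)"
      by (intro sum.cong) (auto simp: W_def colour_gram_def)
    then show ?thesis using r by simp
  qed
  have N: "N t $$ e - colour_gram r e = t * (y e + t * R e)" if e: "e \<in> E" for e t
  proof -
    obtain i j where ij: "e = (i, j)" by (cases e)
    have lt: "i < n" "j < n" using e E ij by auto
    have "(\<Sum>b<r. W t i b * W t j b) = (\<Sum>b<r. W 0 i b * W 0 j b +
        t * (if b = i mod r then X j b else 0) + t * (if b = j mod r then X i b else 0) + t * t * (X i b * X j b))"
      by (intro sum.cong) (auto simp: W_def algebra_simps)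
    also have "\<dots> = colour_gram r e + t * X j (i mod r) + t * X i (j mod r) + t * t * R e"
      using r by (simp only: sum.distrib sum_distrib_left[symmetric] W0) (simp add: ij R_def)
    also have "\<dots> = colour_gram r e + t * (y e + t * R e)"
      using X[of i j, symmetric] e ij by (simp add: algebra_simps)
    finally show ?thesis using lt by (simp add: N_def ij)
  qed
  have term0: "of_rat (a \<beta>) * 0 ^ (sum \<beta> E - k) = c \<beta>" if "\<beta> \<in> ?P" for \<beta>
    using least[OF that] by (cases "a \<beta> = 0") (auto simp: c_def k_def)
  have "g 0 = (\<Sum>\<beta>\<in>?P. c \<beta> * (\<Prod>e\<in>E. y e ^ \<beta> e))"
    unfolding g_def by (intro sum.cong refl) (simp add: term0)
  then have "g 0 \<noteq> 0" using y by simp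
  moreover have "isCont g 0" unfolding g_def by (intro continuous_intros)
  ultimately have ev1: "eventually (\<lambda>t. g t \<noteq> 0) (at 0)"
    by (metis isCont_def tendsto_imp_eventually_ne)
  \<comment> \<open>The first r indices have distinct colours, so the leading block at the base
    point is the identity.\<close>
  have G0: "G 0 = 1\<^sub>m r"
    by (intro eq_matI) (auto simp: G_def W0 colour_gram_def)
  \<comment> \<open>The Leibniz formula exhibits the determinant as a polynomial in t, hence as
    continuous.\<close>
  have detG: "Determinant.det (G t) = (\<Sum>p | p permutes {0..<r}. signof p *
      (\<Prod>i = 0..<r. \<Sum>b<r. W t i b * W t (p i) b))" for t
  proof -
    have "G t $$ (i, p i) = (\<Sum>b<r. W t i b * W t (p i) b)" if "p permutes {0..<r}" "i \<in> {0..<r}" for p i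
      using that permutes_in_image[OF that(1), of i] by (simp add: G_def)
    then show ?thesis
      by (subst Determinant.det_def'[of _ r]) (auto simp: G_def intro!: sum.cong prod.cong)
  qed
  have "isCont (\<lambda>t. Determinant.det (G t)) 0"
    unfolding detG W_def by (intro continuous_intros)
  moreover have "Determinant.det (G 0) \<noteq> 0" by (simp add: G0)
  ultimately have ev2: "eventually (\<lambda>t. Determinant.det (G t) \<noteq> 0) (at 0)"
    unfolding isCont_def by (rule tendsto_imp_eventually_ne)
  have ev3: "eventually (\<lambda>t::'a. t \<noteq> 0) (at 0)" by (rule eventually_neq_at_within)
  from eventually_happens'[OF _ eventually_conj[OF ev1 eventually_conj[OF ev2 ev3]]]
  obtain t where t: "g t \<noteq> 0" "Determinant.det (G t) \<noteq> 0" "t \<noteq> 0" by auto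
  have "N t \<in> sym_rank_mats n r"
    unfolding N_def using gram_mem_sym_rank_mats[OF r(2), of "W t"] t(2) by (simp add: G_def)
  moreover have "(\<Sum>\<beta>\<in>?P. of_rat (a \<beta>) * (\<Prod>e\<in>E. (N t $$ e - colour_gram r e) ^ \<beta> e)) = t ^ k * g t"
    unfolding g_def sum_distrib_left
  proof (intro sum.cong refl)
    fix \<beta> assume \<beta>: "\<beta> \<in> ?P"
    have "(\<Prod>e\<in>E. (N t $$ e - colour_gram r e) ^ \<beta> e) = (\<Prod>e\<in>E. t ^ \<beta> e * (y e + t * R e) ^ \<beta> e)"
      using N by (intro prod.cong refl) (simp add: power_mult_distrib)
    also have "\<dots> = t ^ sum \<beta> E * (\<Prod>e\<in>E. (y e + t * R e) ^ \<beta> e)"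
      by (simp add: prod.distrib power_sum)
    finally have *: "(\<Prod>e\<in>E. (N t $$ e - colour_gram r e) ^ \<beta> e)
      = t ^ sum \<beta> E * (\<Prod>e\<in>E. (y e + t * R e) ^ \<beta> e)" .
    show "of_rat (a \<beta>) * (\<Prod>e\<in>E. (N t $$ e - colour_gram r e) ^ \<beta> e) =
      t ^ k * (of_rat (a \<beta>) * t ^ (sum \<beta> E - k) * (\<Prod>e\<in>E. (y e + t * R e) ^ \<beta> e))"
    proof (cases "a \<beta> = 0")
      case False
      then have "k \<le> sum \<beta> E" using least[OF \<beta>] by (simp add: k_def)
      then have "t ^ sum \<beta> E = t ^ k * t ^ (sum \<beta> E - k)" by (simp flip: power_add)
      then show ?thesis unfolding * by (simp only: mult_ac)
    qed simp
  qed
  ultimately show ?thesis using t by (intro bexI[of _ "N t"]) simp_all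
qed

text \<open>A symmetric matrix of rank \<open>r\<close> is \<open>U S U\<^sup>T\<close> with \<open>U\<close> the identity on some \<open>r\<close> rows \<open>I\<close> and \<open>S\<close> symmetric,
  both indexed by \<open>I\<close>. The free parameters are the remaining rows of \<open>U\<close> and the upper triangle of
  \<open>S\<close>, so their number is exactly the dimension of the rank-\<open>r\<close> locus.\<close>
definition param_index :: "nat \<Rightarrow> nat set \<Rightarrow> (nat \<times> nat) set" where
  "param_index n I = ({..<n} - I) \<times> I \<union> {(a, b). a \<in> I \<and> b \<in> I \<and> a \<le> b}"

text \<open>One assignment \<open>z\<close> carries both matrices: pairs with first component
  outside \<open>I\<close> are entries of U, pairs inside \<open>I\<close> are entries of S.
  \<open>min\<close> and \<open>max\<close> read S from its upper triangle.\<close>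

definition param_entry :: "nat set \<Rightarrow> nat \<times> nat \<Rightarrow> (nat \<times> nat \<Rightarrow> 'a::field_char_0) \<Rightarrow> 'a" where
  "param_entry I = (\<lambda>(i, j) z. \<Sum>a\<in>I. \<Sum>b\<in>I.
     (if i \<in> I then if i = a then 1 else 0 else z (i, a)) * z (min a b, max a b) *
     (if j \<in> I then if j = b then 1 else 0 else z (j, b)))"

lemma card_less_pairs:
  fixes I :: "'i::linorder set"
  assumes "finite I"
  shows "2 * card {(a, b). a \<in> I \<and> b \<in> I \<and> a < b} + card I = card I * card I"
proof -
  let ?L = "{(a, b). a \<in> I \<and> b \<in> I \<and> a < b}" and ?G = "{(a, b). a \<in> I \<and> b \<in> I \<and> b < a}"
  let ?D = "(\<lambda>a. (a, a)) ` I"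
  have fin: "finite ?L" "finite ?G"
    by (rule finite_subset[of _ "I \<times> I"]; use assms in auto)+
  have "card ?G = card ?L"
    by (rule bij_betw_same_card[of prod.swap]) (auto simp: bij_betw_def inj_on_def image_def)
  moreover have "card ?D = card I" by (intro card_image inj_onI) auto
  moreover have "I \<times> I = ?L \<union> (?G \<union> ?D)" by auto
  moreover have "card (?L \<union> (?G \<union> ?D)) = card ?L + (card ?G + card ?D)"
    using fin assms by (subst card_Un_disjoint; (subst card_Un_disjoint)?) auto
  ultimately show ?thesis using card_cartesian_product[of I I] by simp
qed

text \<open>The count (n - r) r + r (r + 1) / 2 equals nr - r (r - 1) / 2. The correction is left as
  a set of pairs because the same set reappears as the roots in \<open>tangent_onto_growth\<close>,
  so the two counts match without being evaluated.\<close>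

lemma card_param_index:
  assumes "I \<subseteq> {..<n}" "card I = r"
  shows "card (param_index n I) + card {(a, b). a < b \<and> b < r} = n * r"
proof -
  have fin: "finite I" using assms(1) by (rule finite_subset) simp
  have "r \<le> n" using card_mono[OF _ assms(1)] assms(2) by simp
  let ?L = "{(a, b). a \<in> I \<and> b \<in> I \<and> a < b}" and ?D = "(\<lambda>a. (a, a)) ` I"
  have fL: "finite ?L" by (rule finite_subset[of _ "I \<times> I"]) (use fin in auto)
  have "{(a, b). a \<in> I \<and> b \<in> I \<and> a \<le> b} = ?L \<union> ?D" by auto
  moreover have "card (?L \<union> ?D) = card ?L + r"
    using fin fL assms(2) by (subst card_Un_disjoint) (auto simp: card_image inj_on_def)
  ultimately have "card {(a, b). a \<in> I \<and> b \<in> I \<and> a \<le> b} = card ?L + r" "finite {(a, b). a \<in> I \<and> b \<in> I \<and> a \<le> b}"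
    using fin fL by auto
  then have "card (param_index n I) = (n - r) * r + (card ?L + r)"
    unfolding param_index_def using fin assms
    by (subst card_Un_disjoint) (auto simp: card_cartesian_product card_Diff_subset)
  moreover have "2 * card ?L + r = r * r" using card_less_pairs[OF fin] assms(2) by simp
  moreover have "2 * card {(a, b). a < b \<and> b < r} + r = r * r"
  proof -
    have "{(a, b). a < b \<and> b < r} = {(a, b). a \<in> {..<r} \<and> b \<in> {..<r} \<and> a < b}" by auto
    then show ?thesis using card_less_pairs[of "{..<r}"] by simp
  qed
  moreover have "(n - r) * r + r * r = n * r"
    using \<open>r \<le> n\<close> by (metis add_mult_distrib le_add_diff_inverse2)
  ultimately show ?thesis by linarith
qed

lemma param_entry_poly:
  assumes "I \<subseteq> {..<n}" "i < n" "j < n"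
  shows "param_entry I (i, j) \<in> poly_funs (param_index n I) 3"
proof -
  have fI: "finite I" using assms(1) by (rule finite_subset) simp
  have "{(a, b). a \<in> I \<and> b \<in> I \<and> a \<le> b} \<subseteq> I \<times> I" by auto
  then have fin: "finite (param_index n I)"
    unfolding param_index_def using fI by (auto intro: finite_subset)
  have u: "(\<lambda>z. if i \<in> I then if i = a then 1 else 0 else z (i, a)) \<in> poly_funs (param_index n I) 1"
    if "a \<in> I" "i < n" for i a
  proof (cases "i \<in> I")
    case True
    then show ?thesis
      by (cases "i = a") (simp_all add: poly_funs_const[of 1, simplified] poly_funs_zero)
  next
    case False
    then show ?thesis
      using poly_funs_var[OF fin, of "(i, a)" 1] that by (simp add: param_index_def)
  qed
  have s: "(\<lambda>z. z (min a b, max a b)) \<in> poly_funs (param_index n I) 1" if "a \<in> I" "b \<in> I" for a b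
    using that by (intro poly_funs_var[OF fin]) (auto simp: param_index_def min_def max_def)
  have summand: "(\<lambda>z. (if i \<in> I then if i = a then 1 else 0 else z (i, a)) * z (min a b, max a b) *
     (if j \<in> I then if j = b then 1 else 0 else z (j, b))) \<in> poly_funs (param_index n I) (1 + 1 + 1)"
    if "a \<in> I" "b \<in> I" for a b
    using that assms by (intro poly_funs_mult u s)
  have three: "(3::nat) = 1 + 1 + 1" by simp
  show ?thesis unfolding param_entry_def prod.case three
    by (intro poly_funs_sum summand)
qed

text \<open>The index set \<open>I\<close> depends on the matrix; the locus is covered by finitely
  many charts, one for each \<open>I\<close>.\<close>

lemma sym_rank_mats_param:
  assumes "M \<in> sym_rank_mats n r"
  obtains I z where "I \<subseteq> {..<n}" "card I = r"
    "\<And>i j. i < n \<Longrightarrow> j < n \<Longrightarrow> M $$ (i, j) = param_entry I (i, j) z"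
proof -
  obtain I Y where I: "I \<subseteq> {..<n}" "card I = r"
    and Y: "\<And>a b. a \<in> I \<Longrightarrow> b \<in> I \<Longrightarrow> Y a b = (if a = b then 1 else 0)"
    and eq: "\<And>i j. i < n \<Longrightarrow> j < n \<Longrightarrow> M $$ (i, j) = (\<Sum>a\<in>I. \<Sum>b\<in>I. Y i a * M $$ (a, b) * Y j b)"
    using sym_rank_mats_factorization[OF assms] by blast
  have M: "M \<in> carrier_mat n n" "transpose_mat M = M"
    using assms by (auto simp: sym_rank_mats_def)
  have sym: "M $$ (i, j) = M $$ (j, i)" if "i < n" "j < n" for i j
    using arg_cong[OF M(2), of "\<lambda>A. A $$ (i, j)"] that M(1) by simp
  define z where "z = (\<lambda>(i, a). if i \<in> I then M $$ (i, a) else Y i a)"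
  have s: "z (min a b, max a b) = M $$ (a, b)" if "a \<in> I" "b \<in> I" for a b
    using that I sym[of a b] by (auto simp: z_def min_def max_def)
  have u: "(if i \<in> I then if i = a then 1 else 0 else z (i, a)) = Y i a" if "a \<in> I" for i a
    using Y that by (auto simp: z_def)
  show ?thesis
  proof (rule that[OF I])
    fix i j assume "i < n" "j < n"
    then show "M $$ (i, j) = param_entry I (i, j) z"
      unfolding eq[OF \<open>i < n\<close> \<open>j < n\<close>] param_entry_def prod.case
      by (intro sum.cong refl) (simp only: s u)
  qed
qed

section \<open>Finitely many values for every entry\<close>

lemma finite_param_index: "I \<subseteq> {..<n} \<Longrightarrow> finite (param_index n I)"
  by (rule finite_subset[of _ "{..<n} \<times> {..<n}"]) (auto simp: param_index_def)

text \<open>The relation holds in the chart \<open>I\<close> only, but its coefficients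
  \<open>C k\<close> are polynomials in the matrix entries. Hence the matrix of
  \<open>gram_nonvanishing\<close> may lie in any chart: it shows that \<open>C k\<close> is not
  zero on the locus, and genericity carries this to \<open>M\<close>. On \<open>E\<close> the
  completion agrees with \<open>M\<close>, so all completions in the chart share one univariate
  equation.\<close>

lemma completion_entry_finite:
  fixes M :: "'a::real_normed_field mat"
  assumes r: "0 < r" "r \<le> n" and E: "E \<subseteq> {..<n} \<times> {..<n}"
    and onto: "\<And>y. \<exists>X::nat \<Rightarrow> nat \<Rightarrow> 'a. \<forall>(i, j)\<in>E. X i (j mod r) + X j (i mod r) = y (i, j)"
    and gen: "generic_sym_rank n r M"
    and I: "I \<subseteq> {..<n}" and card: "card E = card (param_index n I)" and ij: "i < n" "j < n"
  shows "finite {t. \<exists>z. t = param_entry I (i, j) z \<and> (\<forall>e\<in>E. M $$ e = param_entry I e z)}" (is "finite ?T")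
proof (cases "(i, j) \<in> E")
  case True
  then have "?T \<subseteq> {M $$ (i, j)}" by force
  then show ?thesis by (rule finite_subset) simp
next
  case False
  have finE: "finite E" using E by (rule finite_subset) simp
  let ?o = "colour_gram r :: nat \<times> nat \<Rightarrow> 'a"
  define A where "A = insert (i, j) E"
  define f where "f e z = param_entry I e z - ?o e" for e z
  \<comment> \<open>The shift is rational, so \<open>C k\<close> remains a polynomial with rational
    coefficients.\<close>
  have o: "?o e = of_rat (colour_gram r e)" for e by (auto simp: colour_gram_def case_prod_beta)
  have offset: "(\<lambda>z. ?o e) \<in> poly_funs K D" for e D and K :: "(nat \<times> nat) set"
    unfolding o by (rule poly_funs_const)
  have "f e \<in> poly_funs (param_index n I) 3" if "e \<in> A" for e
  proof -
    have "fst e < n" "snd e < n" using that E ij by (auto simp: A_def)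
    then have "param_entry I e \<in> poly_funs (param_index n I) 3"
      using param_entry_poly[OF I, of "fst e" "snd e"] by simp
    then show ?thesis unfolding f_def by (intro poly_funs_diff offset)
  qed
  moreover have "finite A" "card (param_index n I) < card A"
    using finE False card by (simp_all add: A_def)
  ultimately obtain D a \<alpha> where \<alpha>: "\<alpha> \<in> PiE A (\<lambda>_. {..D})" "a \<alpha> \<noteq> 0"
    and rel: "\<And>z. (\<Sum>\<alpha>\<in>PiE A (\<lambda>_. {..D}). of_rat (a \<alpha>) * (\<Prod>e\<in>A. f e z ^ \<alpha> e)) = 0"
    using poly_funs_dependent[OF finite_param_index[OF I], of A f 3] by blast
  define C where "C k x = (\<Sum>\<beta>\<in>PiE E (\<lambda>_. {..D}). of_rat (a (\<beta>((i, j) := k))) *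
    (\<Prod>e\<in>E. (x e - ?o e) ^ \<beta> e))" for k and x :: "nat \<times> nat \<Rightarrow> 'a"
  obtain k \<beta> where k: "k \<le> D" and \<beta>: "\<beta> \<in> PiE E (\<lambda>_. {..D})" "\<alpha> = \<beta>((i, j) := k)"
    using \<alpha>(1) unfolding A_def PiE_insert_eq by auto
  have "a (\<beta>((i, j) := k)) \<noteq> 0" using \<alpha>(2) unfolding \<beta>(2) .
  from gram_nonvanishing[where a = "\<lambda>\<beta>. a (\<beta>((i, j) := k))", OF r E onto \<beta>(1) this]
  obtain N where N: "N \<in> sym_rank_mats n r" "C k (\<lambda>e. N $$ e) \<noteq> 0" unfolding C_def by blast
  have "C k \<in> poly_funs ({..<n} \<times> {..<n}) (0 + D * card E)"
  proof -
    have "(\<lambda>x. (x e - ?o e) ^ \<beta> e) \<in> poly_funs ({..<n} \<times> {..<n}) D"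
      if "e \<in> E" "\<beta> \<in> PiE E (\<lambda>_. {..D})" for e \<beta>
    proof -
      have "\<beta> e \<le> D" using that by auto
      moreover have "(\<lambda>x. (x e - ?o e) ^ \<beta> e) \<in> poly_funs ({..<n} \<times> {..<n}) (1 * \<beta> e)"
        using that E by (intro poly_funs_power poly_funs_diff offset poly_funs_var) auto
      ultimately show ?thesis using poly_funs_mono[of "1 * \<beta> e" D] by auto
    qed
    then show ?thesis unfolding C_def
      by (intro poly_funs_sum poly_funs_mult poly_funs_prod poly_funs_const)
  qed
  then obtain p where p: "mpoly_vars p \<subseteq> {..<n} \<times> {..<n}" "\<forall>x. mpoly_eval x p = C k x"
    using poly_funs_eq_mpoly_eval[of "{..<n} \<times> {..<n}" "C k"] by blast
  have CM: "C k (\<lambda>e. M $$ e) \<noteq> 0"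
    using gen p N unfolding generic_sym_rank_def by metis
  let ?S = "{s. (\<Sum>k\<le>D. C k (\<lambda>e. M $$ e) * s ^ k) = 0}"
  have "finite ?S" by (rule polyfun_roots_finite[where c = "\<lambda>k. C k (\<lambda>e. M $$ e)", OF CM k])
  moreover have "?T \<subseteq> (\<lambda>s. s + ?o (i, j)) ` ?S"
  proof
    fix t assume "t \<in> ?T"
    then obtain z where z: "t = param_entry I (i, j) z" "\<And>e. e \<in> E \<Longrightarrow> M $$ e = param_entry I e z"
      by blast
    have pr: "(\<Prod>e\<in>A. f e z ^ (\<beta>((i, j) := k)) e) = (\<Prod>e\<in>E. (M $$ e - ?o e) ^ \<beta> e) * (t - ?o (i, j)) ^ k" for \<beta> k
    proof -
      have "(\<Prod>e\<in>E. f e z ^ (\<beta>((i, j) := k)) e) = (\<Prod>e\<in>E. (M $$ e - ?o e) ^ \<beta> e)"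
        using False z(2) by (intro prod.cong refl) (auto simp: f_def)
      then show ?thesis using False finE z(1) by (simp add: A_def f_def mult.commute)
    qed
    have "(\<Sum>k\<le>D. C k (\<lambda>e. M $$ e) * (t - ?o (i, j)) ^ k) = 0"
      using rel[of z] unfolding A_def[symmetric] pr C_def sum_distrib_right
      unfolding A_def sum_PiE_insert[OF finE False] unfolding A_def[symmetric] pr
      by (simp only: mult.assoc)
    then show "t \<in> (\<lambda>s. s + ?o (i, j)) ` ?S" by (intro image_eqI[of _ _ "t - ?o (i, j)"]) auto
  qed
  ultimately show ?thesis by (blast intro: finite_subset)
qed

text \<open>A completion is determined by its entries in the index square, and each of them lies in
  a union of finite sets over the finitely many charts.\<close>

lemma finite_sym_completions:
  fixes M :: "'a::real_normed_field mat"
  assumes r: "0 < r" "r \<le> n" and E: "E \<subseteq> {..<n} \<times> {..<n}" "E \<subseteq> \<Omega>"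
    and onto: "\<And>y. \<exists>X::nat \<Rightarrow> nat \<Rightarrow> 'a. \<forall>(i, j)\<in>E. X i (j mod r) + X j (i mod r) = y (i, j)"
    and gen: "generic_sym_rank n r M"
    and card: "card E + card {(a, b). a < b \<and> b < r} = n * r"
  shows "finite (sym_completions n r M \<Omega>)"
proof -
  define T where "T I e = {t. \<exists>z. t = param_entry I e z \<and> (\<forall>e\<in>E. M $$ e = param_entry I e z)}" for I e
  define F where "F e = (\<Union>I\<in>{I. I \<subseteq> {..<n} \<and> card I = r}. T I e)" for e
  let ?B = "{..<n} \<times> {..<n}"
  have finF: "finite (F e)" if "e \<in> ?B" for e
  proof -
    have "finite (T I e)" if "I \<subseteq> {..<n}" "card I = r" for I
    proof -
      have "card E = card (param_index n I)" using card card_param_index[OF that] by linarith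
      then show ?thesis
        using completion_entry_finite[OF r E(1) onto gen that(1), of "fst e" "snd e"] \<open>e \<in> ?B\<close>
        by (auto simp: T_def)
    qed
    moreover have "finite {I. I \<subseteq> {..<n} \<and> card I = r}"
      by (rule finite_subset[of _ "Pow {..<n}"]) auto
    ultimately show ?thesis unfolding F_def by blast
  qed
  have "(\<lambda>M'. restrict (\<lambda>e. M' $$ e) ?B) ` sym_completions n r M \<Omega> \<subseteq> PiE ?B F"
  proof (intro image_subsetI restrict_PiE_iff[THEN iffD2] ballI)
    fix M' e assume M': "M' \<in> sym_completions n r M \<Omega>" and e: "e \<in> ?B"
    then have "M' \<in> sym_rank_mats n r" by (simp add: sym_completions_def)
    then obtain I z where I: "I \<subseteq> {..<n}" "card I = r"
      and z: "\<And>i j. i < n \<Longrightarrow> j < n \<Longrightarrow> M' $$ (i, j) = param_entry I (i, j) z"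
      using sym_rank_mats_param by blast
    have z': "M' $$ e = param_entry I e z" if "e \<in> ?B" for e using z that by auto
    have "M $$ e = param_entry I e z" if "e \<in> E" for e
    proof -
      have "M' $$ e = M $$ e" using M' E(2) that by (auto simp: sym_completions_def)
      moreover have "e \<in> ?B" using E(1) that by blast
      ultimately show ?thesis using z' by metis
    qed
    then have "M' $$ e \<in> T I e" unfolding T_def using z'[OF e] by blast
    then show "M' $$ e \<in> F e" using I unfolding F_def by blast
  qed
  moreover have "finite (PiE ?B F)" using finF by (intro finite_PiE) auto
  moreover have "inj_on (\<lambda>M'. restrict (\<lambda>e. M' $$ e) ?B) (sym_completions n r M \<Omega>)"
  proof (rule inj_onI)
    fix A B assume AB: "A \<in> sym_completions n r M \<Omega>" "B \<in> sym_completions n r M \<Omega>"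
      and eq: "restrict (\<lambda>e. A $$ e) ?B = restrict (\<lambda>e. B $$ e) ?B"
    have dim: "A \<in> carrier_mat n n" "B \<in> carrier_mat n n"
      using AB by (auto simp: sym_completions_def sym_rank_mats_def)
    have "A $$ (i, j) = B $$ (i, j)" if "i < n" "j < n" for i j
      using fun_cong[OF eq, of "(i, j)"] that by simp
    then show "A = B" using dim by (intro eq_matI) auto
  qed
  ultimately show ?thesis by (meson finite_imageD finite_subset)
qed

text \<open>The colouring modulo r makes sense for positive r only. In rank 0 the chart is empty and
  leaves just the zero matrix.\<close>

lemma finite_sym_completions_rank_0:
  fixes M :: "'a::field_char_0 mat"
  shows "finite (sym_completions n 0 M \<Omega>)"
proof -
  have "A = 0\<^sub>m n n" if "A \<in> sym_completions n 0 M \<Omega>" for A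
  proof -
    have A: "A \<in> sym_rank_mats n 0" using that by (simp add: sym_completions_def)
    then obtain I z where I: "I \<subseteq> {..<n}" "card I = 0"
      and z: "\<And>i j. i < n \<Longrightarrow> j < n \<Longrightarrow> A $$ (i, j) = param_entry I (i, j) z"
      using sym_rank_mats_param by blast
    have "I = {}" using I finite_subset[OF I(1)] by simp
    then show ?thesis using z A
      by (intro eq_matI) (auto simp: param_entry_def sym_rank_mats_def)
  qed
  then have "sym_completions n 0 M \<Omega> \<subseteq> {0\<^sub>m n n}" by blast
  then show ?thesis by (rule finite_subset) simp
qed

section \<open>Cuts of the colour graphs\<close>

text \<open>Vertex set of the component for the colours a and b. In it an index i of one colour
  carries the variable of i at the other colour, so the index alone names the vertex.\<close>

definition colour_union :: "nat \<Rightarrow> nat \<Rightarrow> nat \<Rightarrow> nat \<Rightarrow> nat set" where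
  "colour_union n r a b = {i. i < n \<and> (i mod r = a \<or> i mod r = b)}"

text \<open>Positions that let the growth argument below attach a new vertex; a diagonal position
  \<open>(i, i)\<close> determines the coordinate of \<open>i\<close> on its own, hence counts even without leaving \<open>T\<close>.\<close>
definition colour_cut :: "nat \<Rightarrow> nat \<Rightarrow> nat \<Rightarrow> nat \<Rightarrow> nat set \<Rightarrow> (nat \<times> nat) set" where
  "colour_cut n r a b T = {(i, j) \<in> sym_positions n.
     {i mod r, j mod r} = {a, b} \<and> ((i \<in> T) \<noteq> (j \<in> T) \<or> i = j \<and> i \<in> T)}"

text \<open>\<open>T\<close> stands for the vertices not yet reached. For distinct colours a root is
  always reached, so \<open>T\<close> is never everything; for equal colours there is no root, and
  growth has to start at a diagonal position.\<close>

definition cut_sides :: "nat \<Rightarrow> nat \<Rightarrow> nat \<Rightarrow> nat \<Rightarrow> nat set set" where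
  "cut_sides n r a b = {T. T \<subseteq> colour_union n r a b \<and> T \<noteq> {} \<and> (a \<noteq> b \<longrightarrow> T \<noteq> colour_union n r a b)}"

text \<open>The system is triangular: the variable p occurs in the new equation but in none of the
  old ones, so it can be set last.\<close>

lemma onto_insert:
  fixes Z :: "(nat \<times> nat) set"
  assumes onto: "\<forall>y. \<exists>X::nat \<times> nat \<Rightarrow> 'a::field_char_0. \<forall>(i, j)\<in>E. X (i, j mod r) + X (j, i mod r) = y (i, j)"
    and ends: "\<forall>(i, j)\<in>E. (i, j mod r) \<in> Z \<and> (j, i mod r) \<in> Z"
    and p: "p \<notin> Z" "p = (i, j mod r) \<or> p = (j, i mod r)"
  shows "\<forall>y. \<exists>X::nat \<times> nat \<Rightarrow> 'a. \<forall>(i, j)\<in>insert (i, j) E. X (i, j mod r) + X (j, i mod r) = y (i, j)"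
proof
  fix y :: "nat \<times> nat \<Rightarrow> 'a"
  from spec[OF onto, of y] obtain X :: "nat \<times> nat \<Rightarrow> 'a"
    where X: "\<forall>(i, j)\<in>E. X (i, j mod r) + X (j, i mod r) = y (i, j)" ..
  \<comment> \<open>On the diagonal both ends are the same variable and the equation reads 2 v = y,
    solvable in characteristic 0.\<close>
  define v where "v = (if (i, j mod r) = (j, i mod r) then y (i, j) / 2
    else if p = (i, j mod r) then y (i, j) - X (j, i mod r) else y (i, j) - X (i, j mod r))"
  have old: "(X(p := v)) (k, l mod r) + (X(p := v)) (l, k mod r) = y (k, l)" if "(k, l) \<in> E" for k l
  proof -
    have "(k, l mod r) \<noteq> p" "(l, k mod r) \<noteq> p" using ends that p(1) by auto
    then show ?thesis using X that by auto
  qed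
  have new: "(X(p := v)) (i, j mod r) + (X(p := v)) (j, i mod r) = y (i, j)"
  proof (cases "(i, j mod r) = (j, i mod r)")
    case True
    then have "p = (i, j mod r)" using p(2) by metis
    then have "(X(p := v)) (i, j mod r) = v" "(X(p := v)) (j, i mod r) = v"
      using True fun_upd_same[of X p v] by metis+
    moreover have "v = y (i, j) / 2" unfolding v_def by (rule if_P[OF True])
    moreover have "x / 2 + x / 2 = x" for x :: 'a by (simp add: field_simps)
    ultimately show ?thesis by (simp only:)
  next
    case False
    then have v: "v = (if p = (i, j mod r) then y (i, j) - X (j, i mod r) else y (i, j) - X (i, j mod r))"
      by (simp only: v_def if_False)
    show ?thesis
    proof (cases "p = (i, j mod r)")
      case True
      then have "(j, i mod r) \<noteq> p" using False by metis
      then show ?thesis using True v by simp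
    next
      case nu: False
      then have "p = (j, i mod r)" using p(2) by blast
      then show ?thesis using nu v by simp
    qed
  qed
  show "\<exists>X::nat \<times> nat \<Rightarrow> 'a. \<forall>(i, j)\<in>insert (i, j) E. X (i, j mod r) + X (j, i mod r) = y (i, j)"
  proof (intro exI[of _ "X(p := v)"] ballI)
    fix e assume "e \<in> insert (i, j) E"
    then show "case e of (i, j) \<Rightarrow> (X(p := v)) (i, j mod r) + (X(p := v)) (j, i mod r) = y (i, j)"
    proof (elim insertE)
      assume "e = (i, j)"
      then show ?thesis unfolding prod.case using new by simp
    next
      assume "e \<in> E"
      then show ?thesis using old by (cases e) (simp only: prod.case)
    qed
  qed
qed

text \<open>The position \<open>(i, j)\<close> is an edge between the variables \<open>X i (j mod r)\<close> and \<open>X j (i mod r)\<close>.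
  Starting from one root per pair of distinct colours, every step adds one variable together with
  one edge that determines it.\<close>
lemma tangent_onto_growth:
  assumes r: "0 < r" "r \<le> n" and \<Omega>: "\<Omega> \<subseteq> sym_positions n"
    and cuts: "\<And>a b T. a \<le> b \<Longrightarrow> b < r \<Longrightarrow> T \<in> cut_sides n r a b \<Longrightarrow> \<Omega> \<inter> colour_cut n r a b T \<noteq> {}"
    and k: "k + card {(a, b). a < b \<and> b < r} \<le> n * r"
  shows "\<exists>Z E. {(a, b). a < b \<and> b < r} \<subseteq> Z \<and> Z \<subseteq> {..<n} \<times> {..<r} \<and>
    card Z = k + card {(a, b). a < b \<and> b < r} \<and> E \<subseteq> \<Omega> \<and> card E = k \<and>
    (\<forall>(i, j)\<in>E. (i, j mod r) \<in> Z \<and> (j, i mod r) \<in> Z) \<and>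
    (\<forall>y. \<exists>X::nat \<times> nat \<Rightarrow> 'a::field_char_0. \<forall>(i, j)\<in>E. X (i, j mod r) + X (j, i mod r) = y (i, j))"
  using k
proof (induction k)
  case 0
  then show ?case
    using r
    by - (rule exI[where x = "{(a, b). a < b \<and> b < r}"], rule exI[where x = "{}"], auto)
next
  case (Suc k)
  let ?Z0 = "{(a, b). a < b \<and> b < r}" and ?V = "{..<n} \<times> {..<r}"
  obtain Z E where Z: "?Z0 \<subseteq> Z" "Z \<subseteq> ?V" "card Z = k + card ?Z0" and E: "E \<subseteq> \<Omega>" "card E = k"
    and ends: "\<forall>(i, j)\<in>E. (i, j mod r) \<in> Z \<and> (j, i mod r) \<in> Z"
    and onto: "\<forall>y. \<exists>X::nat \<times> nat \<Rightarrow> 'a. \<forall>(i, j)\<in>E. X (i, j mod r) + X (j, i mod r) = y (i, j)"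
    using Suc by auto
  have finZ: "finite Z" using Z(2) by (rule finite_subset) simp
  have "sym_positions n \<subseteq> {..<n} \<times> {..<n}" by (auto simp: sym_positions_def)
  then have finE: "finite E" using E(1) \<Omega> by (meson finite_SigmaI finite_lessThan finite_subset)
  have "card Z < card ?V" using Z(3) Suc.prems by (simp add: card_cartesian_product)
  then obtain v w where vw: "(v, w) \<in> ?V" "(v, w) \<notin> Z" using Z(2) by (metis less_irrefl subsetI subset_antisym surj_pair)
  define a where "a = min (v mod r) w"
  define b where "b = max (v mod r) w"
  have ab: "a \<le> b" "b < r" using vw(1) r by (auto simp: a_def b_def)
  define T where "T = {i \<in> colour_union n r a b. (i, if i mod r = a then b else a) \<notin> Z}"
  have "v \<in> T" using vw by (auto simp: T_def colour_union_def a_def b_def min_def max_def)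
  moreover have "T \<noteq> colour_union n r a b" if "a \<noteq> b"
  proof -
    \<comment> \<open>The index a is below r and so has colour a itself; its variable (a, b) is one
      of the roots \<open>?Z0\<close>.\<close>
    have "a \<in> colour_union n r a b" using ab r by (simp add: colour_union_def)
    moreover have "a \<notin> T" using Z(1) ab that by (auto simp: T_def)
    ultimately show ?thesis by blast
  qed
  ultimately have "T \<in> cut_sides n r a b" by (auto simp: cut_sides_def T_def)
  from cuts[OF ab this] obtain i j where ij: "(i, j) \<in> \<Omega>" "(i, j) \<in> colour_cut n r a b T" by auto
  have lt: "i < n" "j < n" using ij(2) by (auto simp: colour_cut_def sym_positions_def)
  have c: "{i mod r, j mod r} = {a, b}" using ij(2) by (auto simp: colour_cut_def)
  have iT: "i \<in> T \<longleftrightarrow> (i, j mod r) \<notin> Z" and jT: "j \<in> T \<longleftrightarrow> (j, i mod r) \<notin> Z"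
    using c lt by (auto simp: T_def colour_union_def doubleton_eq_iff)
  have "(i \<in> T) \<noteq> (j \<in> T) \<or> i = j \<and> i \<in> T" using ij(2) by (auto simp: colour_cut_def)
  \<comment> \<open>Either exactly one end is new, or the position is a loop whose two ends
    coincide; in both cases one variable is added.\<close>
  then obtain p where p: "p \<notin> Z" "p = (i, j mod r) \<or> p = (j, i mod r)"
    and pends: "(i, j mod r) \<in> insert p Z" "(j, i mod r) \<in> insert p Z"
    using iT jT by blast
  have "(i, j) \<notin> E" using ends p by blast
  then have cE: "card (insert (i, j) E) = Suc k" using finE E(2) by simp
  have cZ: "card (insert p Z) = Suc k + card ?Z0" using finZ p Z(3) by simp
  have pV: "p \<in> ?V" using p(2) lt r by auto
  show ?case
  proof (rule exI[of _ "insert p Z"], rule exI[of _ "insert (i, j) E"], intro conjI)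
    show "\<forall>(k, l)\<in>insert (i, j) E. (k, l mod r) \<in> insert p Z \<and> (l, k mod r) \<in> insert p Z"
      using ends pends by auto
    show "\<forall>y. \<exists>X::nat \<times> nat \<Rightarrow> 'a. \<forall>(i, j)\<in>insert (i, j) E. X (i, j mod r) + X (j, i mod r) = y (i, j)"
      by (rule onto_insert[OF onto ends p])
  qed (use Z pV cE cZ E ij(1) in auto)
qed

text \<open>The growth is run until all n r variables are reached; every variable other than a root
  has contributed one position.\<close>

lemma exists_tangent_onto:
  assumes r: "0 < r" "r \<le> n" and \<Omega>: "\<Omega> \<subseteq> sym_positions n"
    and cuts: "\<And>a b T. a \<le> b \<Longrightarrow> b < r \<Longrightarrow> T \<in> cut_sides n r a b \<Longrightarrow> \<Omega> \<inter> colour_cut n r a b T \<noteq> {}"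
  shows "\<exists>E\<subseteq>\<Omega>. card E + card {(a, b). a < b \<and> b < r} = n * r \<and>
    (\<forall>y. \<exists>X::nat \<Rightarrow> nat \<Rightarrow> 'a::field_char_0. \<forall>(i, j)\<in>E. X i (j mod r) + X j (i mod r) = y (i, j))"
proof -
  have "{(a, b). a < b \<and> b < r} \<subseteq> {..<n} \<times> {..<r}" using r by auto
  from card_mono[OF _ this] have le: "card {(a, b). a < b \<and> b < r} \<le> n * r"
    by (simp add: card_cartesian_product)
  obtain E where E: "E \<subseteq> \<Omega>" "card E = n * r - card {(a, b). a < b \<and> b < r}"
    and onto: "\<forall>y. \<exists>X::nat \<times> nat \<Rightarrow> 'a. \<forall>(i, j)\<in>E. X (i, j mod r) + X (j, i mod r) = y (i, j)"
    using tangent_onto_growth[OF r \<Omega> cuts, of "n * r - card {(a, b). a < b \<and> b < r}", where ?'a = 'a] le by auto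
  have "\<exists>X::nat \<Rightarrow> nat \<Rightarrow> 'a. \<forall>(i, j)\<in>E. X i (j mod r) + X j (i mod r) = y (i, j)" for y
  proof -
    from spec[OF onto, of y] obtain X :: "nat \<times> nat \<Rightarrow> 'a"
      where "\<forall>(i, j)\<in>E. X (i, j mod r) + X (j, i mod r) = y (i, j)" ..
    then show ?thesis by (intro exI[of _ "curry X"]) auto
  qed
  then show ?thesis using E le by (intro exI[of _ E]) auto
qed

section \<open>Lower bounds for the size of a cut\<close>

lemma card_colour_class_ge:
  assumes "0 < r" "a < r"
  shows "n div r \<le> card {i. i < n \<and> i mod r = a}"
proof -
  have "(\<lambda>k. a + r * k) ` {..<n div r} \<subseteq> {i. i < n \<and> i mod r = a}"
  proof clarsimp
    fix k assume "k < n div r"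
    then have "r * Suc k \<le> n" by (metis Suc_leI div_times_less_eq_dividend mult.commute mult_le_mono1 order_trans)
    then show "a + r * k < n \<and> a mod r = a" using assms by simp
  qed
  moreover have "inj_on (\<lambda>k. a + r * k) {..<n div r}" using assms by (auto simp: inj_on_def)
  ultimately show ?thesis using card_inj_on_le[of _ "{..<n div r}"] by fastforce
qed

text \<open>The numbers are the shares of the two sides in two colour classes, and the right-hand
  sum counts crossing pairs. The larger share of each class is at least q/2. The factor 4 comes from
  the case where the larger shares lie on opposite sides, as then one product has to pay for both
  summands.\<close>

lemma bipartite_cut_bound:
  fixes s1 t1 s2 t2 q :: nat
  assumes "q \<le> s1 + t1" "q \<le> s2 + t2"
  shows "q * min (s1 + s2) (t1 + t2) \<le> 4 * (s1 * t2 + t1 * s2)"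
proof -
  consider "s1 \<le> t1" "s2 \<le> t2" | "t1 \<le> s1" "t2 \<le> s2" | "s1 \<le> t1" "t2 \<le> s2" | "t1 \<le> s1" "s2 \<le> t2"
    by linarith
  then show ?thesis
  proof cases
    case 1
    have "q * min (s1 + s2) (t1 + t2) \<le> q * s1 + q * s2" using 1 by (simp add: distrib_left)
    also have "\<dots> \<le> (2 * t2) * s1 + (2 * t1) * s2" using assms 1 by (intro add_mono mult_right_mono) auto
    finally show ?thesis by (simp add: algebra_simps)
  next
    case 2
    have "q * min (s1 + s2) (t1 + t2) \<le> q * t1 + q * t2" using 2 by (simp add: distrib_left)
    also have "\<dots> \<le> (2 * s2) * t1 + (2 * s1) * t2" using assms 2 by (intro add_mono mult_right_mono) auto
    finally show ?thesis by (simp add: algebra_simps)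
  next
    case 3
    have "q * min (s1 + s2) (t1 + t2) \<le> q * (t1 + s2)" using 3 by (intro mult_left_mono) auto
    also have "\<dots> \<le> (2 * s2) * t1 + (2 * t1) * s2"
      unfolding distrib_left using assms 3 by (intro add_mono mult_right_mono) auto
    finally show ?thesis by (simp add: algebra_simps)
  next
    case 4
    have "q * min (s1 + s2) (t1 + t2) \<le> q * (s1 + t2)" using 4 by (intro mult_left_mono) auto
    also have "\<dots> \<le> (2 * t2) * s1 + (2 * s1) * t2"
      unfolding distrib_left using assms 4 by (intro add_mono mult_right_mono) auto
    finally show ?thesis by (simp add: algebra_simps)
  qed
qed

text \<open>Products of vertex sets count ordered pairs, while \<open>sym_positions\<close> lists
  every unordered pair in increasing order.\<close>

lemma inj_on_min_max:
  fixes Q :: "('i::linorder \<times> 'i) set"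
  assumes "\<And>i j. (i, j) \<in> Q \<Longrightarrow> (j, i) \<in> Q \<Longrightarrow> i = j"
  shows "inj_on (\<lambda>(i, j). (min i j, max i j)) Q"
proof (rule inj_onI)
  fix p p' assume p: "p \<in> Q" "p' \<in> Q"
    and eq: "(\<lambda>(i, j). (min i j, max i j)) p = (\<lambda>(i, j). (min i j, max i j)) p'"
  obtain i j k l where ij: "p = (i, j)" "p' = (k, l)" by (cases p, cases p')
  have set: "{min x y, max x y} = {x, y}" for x y :: 'i
    by (cases "x \<le> y") (auto simp: min_def max_def)
  have "min i j = min k l" "max i j = max k l" using eq by (simp_all only: ij prod.case prod.inject)
  then have "{i, j} = {k, l}" by (metis set)
  then consider "i = k" "j = l" | "i = l" "j = k" unfolding doubleton_eq_iff by blast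
  then show "p = p'"
  proof cases
    case 2
    then have "i = j" using p assms[of i j] by (simp only: ij)
    then show ?thesis using 2 by (simp only: ij)
  qed (simp only: ij)
qed

lemma min_max_mem_colour_cut:
  assumes "i < n" "j < n" "{i mod r, j mod r} = {a, b}" "(i \<in> T) \<noteq> (j \<in> T) \<or> i = j \<and> i \<in> T"
  shows "(min i j, max i j) \<in> colour_cut n r a b T"
proof (cases "i \<le> j")
  case True
  then show ?thesis using assms by (simp add: colour_cut_def sym_positions_def)
next
  case False
  then show ?thesis using assms
    by (auto simp: colour_cut_def sym_positions_def doubleton_eq_iff min_def max_def)
qed

text \<open>For equal colours the loops at \<open>T\<close> act like edges to one additional vertex
  on the side \<open>S\<close>: the cut has at least |T| (|S| + 1) positions, whence the correction
  in the minimum. For distinct colours only pairs between the two classes count.\<close>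

lemma card_colour_cut_ge:
  assumes r: "0 < r" and ab: "a \<le> b" "b < r" and T: "T \<subseteq> colour_union n r a b"
  defines "S \<equiv> colour_union n r a b - T"
  shows "(n div r) * min (card T) (card S + (if a = b then 1 else 0)) \<le> 4 * card (colour_cut n r a b T)"
proof -
  let ?U = "colour_union n r a b"
  let ?\<phi> = "\<lambda>(i::nat, j). (min i j, max i j)"
  have finU: "finite ?U" by (rule finite_subset[of _ "{..<n}"]) (auto simp: colour_union_def)
  have finT: "finite T" and finS: "finite S" using finU T by (auto simp: S_def intro: finite_subset)
  have "colour_cut n r a b T \<subseteq> {..<n} \<times> {..<n}" by (auto simp: colour_cut_def sym_positions_def)
  then have finC: "finite (colour_cut n r a b T)" by (rule finite_subset) simp
  have disj: "S \<inter> T = {}" by (auto simp: S_def)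
  show ?thesis
  proof (cases "a = b")
    case True
    let ?Q = "T \<times> S \<union> (\<lambda>i. (i, i)) ` T"
    have img: "?\<phi> ` ?Q \<subseteq> colour_cut n r a b T"
    proof (intro image_subsetI, elim UnE)
      fix x assume "x \<in> T \<times> S"
      then obtain k l where x: "x = (k, l)" "k \<in> T" "l \<in> S" by blast
      then show "?\<phi> x \<in> colour_cut n r a b T"
        unfolding x(1) prod.case using T True
        by (intro min_max_mem_colour_cut) (auto simp: S_def colour_union_def)
    next
      fix x assume "x \<in> (\<lambda>i. (i, i)) ` T"
      then obtain k where x: "x = (k, k)" "k \<in> T" by blast
      then show "?\<phi> x \<in> colour_cut n r a b T"
        unfolding x(1) prod.case using T True
        by (intro min_max_mem_colour_cut) (auto simp: colour_union_def)
    qed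
    have inj: "inj_on ?\<phi> ?Q"
      using disj by (intro inj_on_min_max) blast
    have "card ?Q \<le> card (colour_cut n r a b T)" by (rule card_inj_on_le[OF inj img finC])
    moreover have "card ?Q = card T * card S + card T"
      using finT finS disj by (subst card_Un_disjoint) (auto simp: card_cartesian_product card_image inj_on_def)
    moreover have "(n div r) * min (card T) (card S + 1) \<le> 4 * (card T * card S + card T)"
    proof -
      have "?U = {i. i < n \<and> i mod r = a}" using True by (auto simp: colour_union_def)
      then have "n div r \<le> card ?U" using card_colour_class_ge[OF r, of a n] ab by simp
      also have "card ?U = card T + card S"
        using finU T by (simp add: S_def card_Diff_subset finT card_mono)
      finally have q: "n div r \<le> card T + card S" .
      show ?thesis
      proof (cases "card T \<le> card S + 1")
        case True
        then have "card T + card S \<le> 2 * (card S + 1)" by simp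
        with q have "n div r \<le> 2 * (card S + 1)" by (rule le_trans)
        then have "(n div r) * min (card T) (card S + 1) \<le> (2 * (card S + 1)) * card T"
          by (rule mult_le_mono) simp
        also have "\<dots> \<le> 4 * (card T * card S + card T)" by simp
        finally show ?thesis .
      next
        case False
        then have "card T + card S \<le> 2 * card T" by simp
        with q have "n div r \<le> 2 * card T" by (rule le_trans)
        then have "(n div r) * min (card T) (card S + 1) \<le> (2 * card T) * (card S + 1)"
          by (rule mult_le_mono) simp
        also have "\<dots> \<le> 4 * (card T * card S + card T)" by simp
        finally show ?thesis .
      qed
    qed
    ultimately show ?thesis using True by simp
  next
    case False
    define A where "A = {i. i < n \<and> i mod r = a}"
    define B where "B = {i. i < n \<and> i mod r = b}"
    have U: "?U = A \<union> B" "A \<inter> B = {}" using False by (auto simp: colour_union_def A_def B_def)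
    have fin: "finite A" "finite B" by (simp_all add: A_def B_def)
    let ?Q = "(S \<inter> A) \<times> (T \<inter> B) \<union> (T \<inter> A) \<times> (S \<inter> B)"
    have img: "?\<phi> ` ?Q \<subseteq> colour_cut n r a b T"
    proof (intro image_subsetI)
      fix x assume "x \<in> ?Q"
      then obtain k l where x: "x = (k, l)" "k \<in> A" "l \<in> B" "(k \<in> T) \<noteq> (l \<in> T)"
        using disj by blast
      then show "?\<phi> x \<in> colour_cut n r a b T"
        unfolding x(1) prod.case by (intro min_max_mem_colour_cut) (auto simp: A_def B_def)
    qed
    have inj: "inj_on ?\<phi> ?Q"
      using U(2) by (intro inj_on_min_max) blast
    have "card ?Q \<le> card (colour_cut n r a b T)" by (rule card_inj_on_le[OF inj img finC])
    moreover have "card ?Q = card (S \<inter> A) * card (T \<inter> B) + card (T \<inter> A) * card (S \<inter> B)"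
      using finT finS disj by (subst card_Un_disjoint) (auto simp: card_cartesian_product)
    moreover have split: "card X = card (X \<inter> A) + card (X \<inter> B)" if "X \<subseteq> ?U" for X
    proof -
      have "X = (X \<inter> A) \<union> (X \<inter> B)" using that U by blast
      also have "card \<dots> = card (X \<inter> A) + card (X \<inter> B)"
        using fin U by (intro card_Un_disjoint) auto
      finally show ?thesis .
    qed
    moreover have "card Y = card (S \<inter> Y) + card (T \<inter> Y)" if "Y \<subseteq> ?U" "finite Y" for Y
    proof -
      have "Y = (S \<inter> Y) \<union> (T \<inter> Y)" using that T by (auto simp: S_def)
      also have "card \<dots> = card (S \<inter> Y) + card (T \<inter> Y)"
        using that disj by (intro card_Un_disjoint) auto
      finally show ?thesis .
    qed
    then have "n div r \<le> card (S \<inter> A) + card (T \<inter> A)" "n div r \<le> card (S \<inter> B) + card (T \<inter> B)"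
      using card_colour_class_ge[OF r, of a n] card_colour_class_ge[OF r, of b n] ab U fin
      by (metis A_def B_def Un_upper1 Un_upper2 le_less_trans)+
    from bipartite_cut_bound[OF this]
    have "(n div r) * min (card S) (card T) \<le> 4 * (card (S \<inter> A) * card (T \<inter> B) + card (T \<inter> A) * card (S \<inter> B))"
      using split[of S] split[of T] T by (simp add: S_def)
    ultimately show ?thesis using False by (simp add: min.commute)
  qed
qed

section \<open>Random samples\<close>

lemma finite_sym_positions: "finite (sym_positions n)"
  by (rule finite_subset[of _ "{..<n} \<times> {..<n}"]) (auto simp: sym_positions_def)

lemma card_sym_positions_le: "card (sym_positions n) \<le> n * n"
proof -
  have "card (sym_positions n) \<le> card ({..<n} \<times> {..<n})"
    by (intro card_mono) (auto simp: sym_positions_def)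
  then show ?thesis by (simp add: card_cartesian_product)
qed

text \<open>Drawing without replacement misses e of N objects no more often than drawing with
  replacement, since every miss raises the share of the e objects among those that are left.\<close>

lemma binomial_diff_le_power:
  fixes N e m :: nat
  assumes "e \<le> N" "m \<le> N"
  shows "real ((N - e) choose m) \<le> (1 - real e / real N) ^ m * real (N choose m)"
  using assms
proof (induction m arbitrary: N)
  case 0
  then show ?case by simp
next
  case (Suc m)
  show ?case
  proof (cases "e = N")
    case True
    then show ?thesis by simp
  next
    case False
    then have lt: "e < N" using Suc.prems by simp
    have IH: "real ((N - 1 - e) choose m) \<le> (1 - real e / real (N - 1)) ^ m * real ((N - 1) choose m)"
      using Suc.IH[of "N - 1"] lt Suc.prems by simp
    have mono: "(1 - real e / real (N - 1)) ^ m \<le> (1 - real e / real N) ^ m"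
    proof (cases "N = 1")
      case True
      then show ?thesis using lt by simp
    next
      case False
      then have "real e / real N \<le> real e / real (N - 1)" "real e / real (N - 1) \<le> 1"
        using lt by (auto intro!: divide_left_mono)
      then show ?thesis by (intro power_mono) auto
    qed
    have 1: "real (Suc m) * real ((N - e) choose Suc m) = real (N - e) * real ((N - 1 - e) choose m)"
      using times_binomial_minus1_eq[of "Suc m" "N - e"]
      by (metis diff_Suc_1 diff_commute of_nat_mult zero_less_Suc)
    have 2: "real (Suc m) * real (N choose Suc m) = real N * real ((N - 1) choose m)"
      using times_binomial_minus1_eq[of "Suc m" N] by (metis diff_Suc_1 of_nat_mult zero_less_Suc)
    have "real (Suc m) * real ((N - e) choose Suc m)
        \<le> real (N - e) * ((1 - real e / real N) ^ m * real ((N - 1) choose m))"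
      unfolding 1 using order_trans[OF IH mult_right_mono[OF mono]] by (intro mult_left_mono) auto
    also have "real (N - e) = (1 - real e / real N) * real N"
      using lt by (simp add: of_nat_diff field_simps)
    also have "(1 - real e / real N) * real N * ((1 - real e / real N) ^ m * real ((N - 1) choose m))
        = (1 - real e / real N) ^ Suc m * (real N * real ((N - 1) choose m))"
      by (simp only: power_Suc mult_ac)
    also have "\<dots> = real (Suc m) * ((1 - real e / real N) ^ Suc m * real (N choose Suc m))"
      unfolding 2[symmetric] by (simp only: mult_ac)
    finally show ?thesis by (simp only: mult_le_cancel_left_pos of_nat_0_less_iff zero_less_Suc)
  qed
qed

text \<open>The samples that avoid \<open>E\<close> are the m-subsets of the complement; then 1 - x
  <= exp (- x).\<close>

lemma prob_sample_avoids:
  assumes m: "m \<le> card (sym_positions n)" and E: "E \<subseteq> sym_positions n"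
  shows "measure_pmf.prob (sample_positions n m) {\<Omega>. \<Omega> \<inter> E = {}}
    \<le> exp (- (real m * real (card E) / real (card (sym_positions n))))"
proof -
  let ?P = "sym_positions n"
  let ?S = "{\<Omega>. \<Omega> \<subseteq> ?P \<and> card \<Omega> = m}"
  define N where "N = card ?P"
  have fin: "finite ?P" by (rule finite_sym_positions)
  have e: "card E \<le> N" using card_mono[OF fin E] by (simp add: N_def)
  have finS: "finite ?S" by (rule finite_subset[of _ "Pow ?P"]) (use fin in auto)
  have cS: "card ?S = N choose m" using n_subsets[OF fin] by (simp add: N_def)
  then have pos: "card ?S > 0" using m by (simp add: N_def)
  then have ne: "?S \<noteq> {}" by force
  have "?S \<inter> {\<Omega>. \<Omega> \<inter> E = {}} = {\<Omega>. \<Omega> \<subseteq> ?P - E \<and> card \<Omega> = m}" by blast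
  then have c: "card (?S \<inter> {\<Omega>. \<Omega> \<inter> E = {}}) = (N - card E) choose m"
    using n_subsets[of "?P - E" m] fin E by (simp add: N_def card_Diff_subset finite_subset)
  have "measure_pmf.prob (sample_positions n m) {\<Omega>. \<Omega> \<inter> E = {}} = real ((N - card E) choose m) / real (N choose m)"
    unfolding sample_positions_def by (subst measure_pmf_of_set[OF ne finS]) (simp only: c cS)
  also have "\<dots> \<le> (1 - real (card E) / real N) ^ m"
    using binomial_diff_le_power[OF e, of m] m pos cS by (simp add: N_def pos_divide_le_eq)
  also have "\<dots> \<le> exp (- (real (card E) / real N)) ^ m"
  proof (rule power_mono)
    show "1 - real (card E) / real N \<le> exp (- (real (card E) / real N))"
      using exp_ge_add_one_self[of "- (real (card E) / real N)"] by simp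
    show "0 \<le> 1 - real (card E) / real N" using e by (cases "N = 0") auto
  qed
  also have "\<dots> = exp (- (real m * real (card E) / real N))"
    by (simp flip: exp_of_nat_mult)
  finally show ?thesis by (simp add: N_def)
qed

section \<open>Union bound over the cuts\<close>

lemma sum_Pow_power_card:
  fixes x :: real
  assumes "finite V"
  shows "(\<Sum>T\<in>Pow V. x ^ card T) = (1 + x) ^ card V"
  using prod_add[OF assms, of "\<lambda>_. x" "\<lambda>_. 1"] by (simp add: add.commute)

text \<open>A power with exponent min u v is at most x ^ u + x ^ v, so the sum splits into one over
  the sides and one over their complements. Each is a binomial expansion of (1 + x) ^ |V| without
  its constant term, at most 2 n x because n x <= 1.\<close>

lemma sum_cut_sides_le:
  fixes x :: real
  assumes x: "0 \<le> x" "real n * x \<le> 1" and n: "0 < n"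
  shows "(\<Sum>T\<in>cut_sides n r a b. x ^ min (card T) (card (colour_union n r a b - T) + (if a = b then 1 else 0)))
    \<le> 5 * real n * x"
proof -
  let ?V = "colour_union n r a b"
  have V: "?V \<subseteq> {..<n}" by (auto simp: colour_union_def)
  then have fV: "finite ?V" by (rule finite_subset) simp
  have cV: "card ?V \<le> n" using card_mono[OF _ V] by simp
  have x1: "x \<le> 1" 
  proof -
    have "1 * x \<le> real n * x" using x(1) n by (intro mult_right_mono) auto
    then show ?thesis using x(2) by simp
  qed
  \<comment> \<open>For the whole component the power of the empty complement would be 1. This
    \<open>T\<close> occurs for equal colours only, where the loops raise the exponent to 1.\<close>
  define h where "h T = (if T = ?V then x else x ^ card (?V - T))" for T
  have h0: "0 \<le> h T" for T using x by (simp add: h_def)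
  have bound: "(1 + x) ^ card ?V \<le> 1 + 2 * real n * x"
  proof -
    have "(1 + x) ^ card ?V \<le> (1 + x) ^ n" using cV x by (intro power_increasing) auto
    also have "\<dots> \<le> exp x ^ n" using x by (intro power_mono) auto
    also have "\<dots> = exp (real n * x)" by (simp add: exp_of_nat_mult)
    also have "\<dots> \<le> 1 + real n * x + (real n * x)\<^sup>2" using x by (intro exp_bound) auto
    also have "(real n * x)\<^sup>2 \<le> real n * x" using x by (simp add: power2_eq_square mult_left_le)
    finally show ?thesis by (simp add: mult_ac)
  qed
  have "(\<Sum>T\<in>cut_sides n r a b. x ^ min (card T) (card (?V - T) + (if a = b then 1 else 0)))
      \<le> (\<Sum>T\<in>cut_sides n r a b. x ^ card T + h T)"
  proof (rule sum_mono)
    fix T assume T: "T \<in> cut_sides n r a b"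
    have "x ^ (card (?V - T) + (if a = b then 1 else 0)) \<le> h T"
    proof (cases "T = ?V")
      case True
      then show ?thesis using T by (auto simp: cut_sides_def h_def)
    next
      case False
      then show ?thesis using x x1 by (auto simp: h_def mult_left_le_one_le)
    qed
    then show "x ^ min (card T) (card (?V - T) + (if a = b then 1 else 0)) \<le> x ^ card T + h T"
      using h0[of T] x(1) by (auto simp: min_def intro: add_increasing add_increasing2)
  qed
  also have "\<dots> = (\<Sum>T\<in>cut_sides n r a b. x ^ card T) + (\<Sum>T\<in>cut_sides n r a b. h T)"
    by (rule sum.distrib)
  also have "(\<Sum>T\<in>cut_sides n r a b. x ^ card T) \<le> (\<Sum>T\<in>Pow ?V - {{}}. x ^ card T)"
    using fV x by (intro sum_mono2) (auto simp: cut_sides_def)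
  also have "(\<Sum>T\<in>Pow ?V - {{}}. x ^ card T) = (1 + x) ^ card ?V - 1"
    using fV sum.remove[of "Pow ?V" "{}" "\<lambda>T. x ^ card T"] by (simp add: sum_Pow_power_card)
  also have "(\<Sum>T\<in>cut_sides n r a b. h T) \<le> (\<Sum>T\<in>Pow ?V. h T)"
    using fV h0 by (intro sum_mono2) (auto simp: cut_sides_def)
  also have "(\<Sum>T\<in>Pow ?V. h T) = x + (\<Sum>T\<in>Pow ?V - {?V}. x ^ card (?V - T))"
    using fV sum.remove[of "Pow ?V" ?V h] by (simp add: h_def)
  also have "(\<Sum>T\<in>Pow ?V - {?V}. x ^ card (?V - T)) = (\<Sum>T\<in>Pow ?V. x ^ card (?V - T)) - 1"
    using fV sum.remove[of "Pow ?V" ?V "\<lambda>T. x ^ card (?V - T)"] by simp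
  also have "(\<Sum>T\<in>Pow ?V. x ^ card (?V - T)) = (\<Sum>T\<in>Pow ?V. x ^ card T)"
    by (rule sum.reindex_bij_witness[of _ "\<lambda>T. ?V - T" "\<lambda>T. ?V - T"]) (auto simp: double_diff)
  also have "\<dots> = (1 + x) ^ card ?V" using fV by (rule sum_Pow_power_card)
  finally have "(\<Sum>T\<in>cut_sides n r a b. x ^ min (card T) (card (?V - T) + (if a = b then 1 else 0)))
      \<le> ((1 + x) ^ card ?V - 1) + (x + ((1 + x) ^ card ?V - 1))" by simp
  \<comment> \<open>Each of the two sums gives 2 n x and the whole component gives x, in total at
    most 5 n x.\<close>
  moreover have "1 * x \<le> real n * x" using x(1) n by (intro mult_right_mono) auto
  ultimately show ?thesis using bound by linarith
qed

text \<open>With k the exponent on the right, the cut has at least (n div r) k / 4 of at most n^2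
  positions, so it is missed with probability at most exp (- m k / (8 r n)).\<close>

lemma prob_cut_missed_le:
  fixes n m r :: nat
  assumes n: "2 \<le> n" and r: "0 < r" "r \<le> n" and m: "m \<le> card (sym_positions n)"
    and large: "288 * (real r + 1) * real n * ln (real n) ^ 3 \<le> real m"
    and ab: "a \<le> b" "b < r" and T: "T \<in> cut_sides n r a b"
  shows "measure_pmf.prob (sample_positions n m) {\<Omega>. \<Omega> \<inter> colour_cut n r a b T = {}}
    \<le> (1 / real n ^ 9) ^ min (card T) (card (colour_union n r a b - T) + (if a = b then 1 else 0))"
proof -
  define k where "k = min (card T) (card (colour_union n r a b - T) + (if a = b then 1 else 0))"
  define c where "c = card (colour_cut n r a b T)"
  define N where "N = card (sym_positions n)"
  define L where "L = ln (real n)"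
  define q where "q = n div r"
  \<comment> \<open>Since e <= 4, the logarithm of n is at least 1/2 from n = 2 on.\<close>
  have "exp (1 / 2 :: real) \<le> 2"
  proof (rule power2_le_imp_le)
    have "(exp (1 / 2 :: real))\<^sup>2 = exp 1" by (simp flip: exp_double)
    then show "(exp (1 / 2 :: real))\<^sup>2 \<le> 2\<^sup>2" using exp_le by simp
  qed simp
  then have "exp (1 / 2) \<le> real n" using n by linarith
  then have L: "1 / 2 \<le> L" unfolding L_def using n by (subst ln_ge_iff) auto
  have cut: "q * k \<le> 4 * c"
    unfolding q_def k_def c_def using T ab r by (intro card_colour_cut_ge) (auto simp: cut_sides_def)
  have "(0, 0) \<in> sym_positions n" using n by (simp add: sym_positions_def)
  then have N0: "0 < N" unfolding N_def using finite_sym_positions card_gt_0_iff by blast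
  have Nn: "real N \<le> real n * real n"
    using card_sym_positions_le[of n] unfolding N_def by (metis of_nat_le_iff of_nat_mult)
  \<comment> \<open>Rounding n / r down loses at most a factor 2, as r <= n.\<close>
  have q: "real n \<le> 2 * real r * real q"
  proof -
    have "1 \<le> q" unfolding q_def using r by (simp add: Suc_leI div_greater_zero_iff)
    have "n = r * q + n mod r" unfolding q_def by simp
    also have "\<dots> \<le> r * q + r" using r by (intro add_left_mono) (simp add: less_imp_le)
    also have "\<dots> \<le> 2 * r * q" using \<open>1 \<le> q\<close> by simp
    finally show ?thesis by (metis of_nat_le_iff of_nat_mult of_nat_numeral)
  qed
  \<comment> \<open>The constant 288 is \<open>9 * 8 * 4\<close>: target exponent 9, cut size at least \<open>n k / (8 r)\<close>,
    and \<open>4 L\<^sup>2 \<ge> 1\<close>.\<close>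
  have "9 * L * real k * (8 * real r * N) \<le> real m * real c * (8 * real r)"
  proof -
    have L2: "1 / 4 \<le> L\<^sup>2" using power_mono[OF L, of 2] by (simp add: power2_eq_square)
    have "9 * L * real k * (8 * real r * N) \<le> 9 * L * real k * (8 * real r * (real n * real n))"
      using Nn L by (intro mult_left_mono) auto
    also have "\<dots> = 72 * real r * 1 * (L * real n * (real n * real k))" by simp
    also have "\<dots> \<le> 72 * (real r + 1) * (4 * L\<^sup>2) * (L * real n * (2 * real r * real q * real k))"
      using L2 L q by (intro mult_mono) auto
    also have "\<dots> = (288 * (real r + 1) * real n * L ^ 3) * (2 * real r * (real q * real k))"
      by (simp add: power3_eq_cube power2_eq_square)
    also have "\<dots> \<le> real m * (2 * real r * (4 * real c))"
    proof (rule mult_mono)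
      have "real (q * k) \<le> real (4 * c)" using cut by (rule of_nat_mono)
      then show "2 * real r * (real q * real k) \<le> 2 * real r * (4 * real c)"
        by (intro mult_left_mono) auto
    qed (use large in \<open>simp_all add: L_def\<close>)
    finally show ?thesis by (simp add: mult_ac)
  qed
  then have "9 * L * real k \<le> real m * real c / real N"
    using N0 r by (simp add: pos_le_divide_eq mult_ac)
  moreover have "exp (- (9 * L * real k)) = (1 / real n ^ 9) ^ k"
  proof -
    have "exp (- (9 * L * real k)) = exp (real k * (real 9 * - L))" by (simp add: mult_ac)
    also have "\<dots> = (exp (- L) ^ 9) ^ k" by (simp only: exp_of_nat_mult)
    also have "exp (- L) = 1 / real n" using n by (simp add: L_def exp_minus inverse_eq_divide)
    finally show ?thesis by (simp add: power_one_over)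
  qed
  moreover have "measure_pmf.prob (sample_positions n m) {\<Omega>. \<Omega> \<inter> colour_cut n r a b T = {}}
      \<le> exp (- (real m * real c / real N))"
    unfolding c_def N_def using m by (intro prob_sample_avoids) (auto simp: colour_cut_def)
  ultimately show ?thesis unfolding k_def[symmetric]
    by (smt (verit) exp_le_cancel_iff)
qed

text \<open>At most r^2 <= n^2 pairs of colours, each failing with probability at most 5 n / n^9,
  give 5 / n^6. This is at most 1 / n^3 because n^3 >= 8; at n = 2 the exponent 9 is the least
  integer for which this estimate works.\<close>

lemma prob_some_cut_missed_le:
  fixes n m r :: nat
  assumes n: "2 \<le> n" and r: "0 < r" "r \<le> n" and m: "m \<le> card (sym_positions n)"
    and large: "288 * (real r + 1) * real n * ln (real n) ^ 3 \<le> real m"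
  shows "measure_pmf.prob (sample_positions n m)
    (\<Union>(a, b)\<in>{(a, b). a \<le> b \<and> b < r}. \<Union>T\<in>cut_sides n r a b. {\<Omega>. \<Omega> \<inter> colour_cut n r a b T = {}})
    \<le> 1 / real n ^ 3"
proof -
  let ?p = "measure_pmf.prob (sample_positions n m)"
  let ?I = "{(a, b). a \<le> b \<and> b < r}"
  define x where "x = 1 / real n ^ 9"
  have x: "0 \<le> x" "real n * x \<le> 1"
    using n self_le_power[of "real n" 9] by (auto simp: x_def divide_le_eq)
  have sub: "?I \<subseteq> {..<r} \<times> {..<r}" by auto
  then have finI: "finite ?I" by (rule finite_subset) simp
  have fin: "finite (cut_sides n r a b)" for a b
    by (rule finite_subset[of _ "Pow {..<n}"]) (auto simp: cut_sides_def colour_union_def)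
  have one: "?p (\<Union>T\<in>cut_sides n r a b. {\<Omega>. \<Omega> \<inter> colour_cut n r a b T = {}}) \<le> 5 * real n * x"
    if ab: "a \<le> b" "b < r" for a b
  proof -
    have "?p (\<Union>T\<in>cut_sides n r a b. {\<Omega>. \<Omega> \<inter> colour_cut n r a b T = {}})
        \<le> (\<Sum>T\<in>cut_sides n r a b. ?p {\<Omega>. \<Omega> \<inter> colour_cut n r a b T = {}})"
      using fin by (intro measure_UNION_le) auto
    also have "\<dots> \<le> (\<Sum>T\<in>cut_sides n r a b. x ^ min (card T) (card (colour_union n r a b - T) + (if a = b then 1 else 0)))"
      unfolding x_def using prob_cut_missed_le[OF assms ab] by (intro sum_mono)
    also have "\<dots> \<le> 5 * real n * x" using x n by (intro sum_cut_sides_le) auto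
    finally show ?thesis .
  qed
  have "?p (\<Union>(a, b)\<in>?I. \<Union>T\<in>cut_sides n r a b. {\<Omega>. \<Omega> \<inter> colour_cut n r a b T = {}})
      \<le> (\<Sum>(a, b)\<in>?I. ?p (\<Union>T\<in>cut_sides n r a b. {\<Omega>. \<Omega> \<inter> colour_cut n r a b T = {}}))"
    using measure_UNION_le[OF finI, of "\<lambda>(a, b). \<Union>T\<in>cut_sides n r a b. {\<Omega>. \<Omega> \<inter> colour_cut n r a b T = {}}"
        "measure_pmf (sample_positions n m)"]
    by (simp add: case_prod_beta)
  also have "\<dots> \<le> (\<Sum>(a, b)\<in>?I. 5 * real n * x)" using one by (intro sum_mono) auto
  also have "\<dots> = real (card ?I) * (5 * real n * x)" by (simp add: case_prod_beta)
  also have "\<dots> \<le> (real n * real n) * (5 * real n * x)"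
  proof (intro mult_right_mono)
    have "card ?I \<le> r * r" using card_mono[OF _ sub] by (simp add: card_cartesian_product)
    also have "\<dots> \<le> n * n" using r by (intro mult_mono) auto
    finally show "real (card ?I) \<le> real n * real n" by (metis of_nat_le_iff of_nat_mult)
  qed (use x in simp)
  also have "\<dots> = 5 / real n ^ 6"
  proof -
    have "real n ^ 9 = real n ^ 6 * (real n * real n * real n)" by (simp add: eval_nat_numeral)
    then show ?thesis using n by (simp add: x_def)
  qed
  also have "\<dots> \<le> 1 / real n ^ 3"
  proof -
    have "(2::real) ^ 3 \<le> real n ^ 3" using n by (intro power_mono) auto
    then have "5 * real n ^ 3 \<le> real n ^ 3 * real n ^ 3" by (intro mult_right_mono) auto
    also have "\<dots> = real n ^ 6" by (simp flip: power_add)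
    finally show ?thesis using n by (simp add: field_simps)
  qed
  finally show ?thesis .
qed

theorem mainTheorem10:
  fixes r :: nat
  shows "\<exists>C::real. C > 0 \<and>
    (\<forall>(n::nat) (m::nat) (M :: 'a::real_normed_field mat).
       n \<ge> 1 \<longrightarrow>
       m \<le> card (sym_positions n) \<longrightarrow>
       real m \<ge> C * real n * (ln (real n)) ^ 3 \<longrightarrow>
       generic_sym_rank n r M \<longrightarrow>
       measure_pmf.prob (sample_positions n m) {\<Omega>. finite (sym_completions n r M \<Omega>)}
         \<ge> 1 - 1 / real n ^ 3)"
proof (intro exI[of _ "288 * (real r + 1)"] conjI allI impI)
  fix n m :: nat and M :: "'a mat"
  assume n: "n \<ge> 1" and m: "m \<le> card (sym_positions n)"
    and large: "real m \<ge> 288 * (real r + 1) * real n * (ln (real n)) ^ 3"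
    and gen: "generic_sym_rank n r M"
  let ?p = "measure_pmf.prob (sample_positions n m)"
  let ?F = "{\<Omega>. finite (sym_completions n r M \<Omega>)}"
  consider "n = 1" | "r = 0" | "2 \<le> n" "0 < r" using n by linarith
  then show "?p ?F \<ge> 1 - 1 / real n ^ 3"
  proof cases
    \<comment> \<open>Here the logarithm is 0 and the sample may be empty, but the claimed lower
      bound is 0 as well.\<close>
    case 1
    then show ?thesis by simp
  next
    case 2
    then show ?thesis by (simp add: finite_sym_completions_rank_0)
  next
    case 3
    have rn: "r \<le> n"
      using gen vec_space.rank_le_nc[of M n n] by (auto simp: generic_sym_rank_def sym_rank_mats_def)
    let ?B = "\<Union>(a, b)\<in>{(a, b). a \<le> b \<and> b < r}. \<Union>T\<in>cut_sides n r a b. {\<Omega>. \<Omega> \<inter> colour_cut n r a b T = {}}"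
    let ?S = "{\<Omega>. \<Omega> \<subseteq> sym_positions n \<and> card \<Omega> = m}"
    have finS: "finite ?S"
      by (rule finite_subset[of _ "Pow (sym_positions n)"]) (auto simp: finite_sym_positions)
    have neS: "?S \<noteq> {}" using obtain_subset_with_card_n[OF m] by auto
    \<comment> \<open>The growth argument concerns samples inside \<open>sym_positions n\<close>, so
      the events are compared on the support \<open>?S\<close>, which has probability 1.\<close>
    have good: "\<Omega> \<in> ?F" if \<Omega>: "\<Omega> \<in> ?S" "\<Omega> \<notin> ?B" for \<Omega>
    proof -
      have "\<Omega> \<inter> colour_cut n r a b T \<noteq> {}" if "a \<le> b" "b < r" "T \<in> cut_sides n r a b" for a b T
        using \<Omega>(2) that by blast
      from exists_tangent_onto[OF 3(2) rn _ this, where ?'a = 'a] \<Omega>(1)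
      obtain E where E: "E \<subseteq> \<Omega>" "card E + card {(a, b). a < b \<and> b < r} = n * r"
        and onto: "\<And>y. \<exists>X::nat \<Rightarrow> nat \<Rightarrow> 'a. \<forall>(i, j)\<in>E. X i (j mod r) + X j (i mod r) = y (i, j)"
        by auto
      have "E \<subseteq> {..<n} \<times> {..<n}" using E(1) \<Omega>(1) by (auto simp: sym_positions_def)
      from finite_sym_completions[OF 3(2) rn this E(1) onto gen E(2)] show ?thesis by simp
    qed
    have "1 = ?p ?S"
      unfolding sample_positions_def using neS finS by (simp add: measure_pmf_of_set)
    also have "\<dots> \<le> ?p (?F \<union> ?B)"
      using good by (intro measure_pmf.finite_measure_mono) auto
    also have "\<dots> \<le> ?p ?F + ?p ?B" by (rule measure_Un_le) auto
    finally show ?thesis using prob_some_cut_missed_le[OF 3 rn m large] by linarith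
  qed
qed simp

end
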